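(* Let $(X,T)$ be a linearly recurrent Cantor system, with a sequence of CKR partitions $(\mathcal P(n);n\in\mathbb N)$ satisfying (KR1)-(KR6) and (LR), associated matrices $(M(n);n\ge1)$, height vectors $H(n)$ and products $P(n)=M(n)M(n-1)\cdots M(2)$, and let $\mu$ be its unique $T$-invariant probability measure. Let $\alpha\in\mathbb R$ and $\lambda=\exp(2i\pi\alpha)$. (1) If $\lambda$ is an eigenvalue of $(X,T,\mu)$, then $\sum_{n\ge1}|||\alpha P(n)H(1)|||^2<\infty$. (2) If $\sum_{n\ge1}|||\alpha P(n)H(1)|||<\infty$, then $\lambda$ is a continuous eigenvalue of $(X,T,\mu)$.
   Context: A Cantor system $(X,T)$ is a Cantor space $X$ together with a homeomorphism $T:X\to X$; it is minimal if the only closed $T$-invariant subsets are $\emptyset$ and $X$. $\mathbb N=\{0,1,2,\dots\}$. A clopen Kakutani-Rokhlin (CKR) partition of $X$ is a partition of $X$ of the form $\{T^{-j}B_k : 1\le k\le C,\ 0\le j<h_k\}$, where $C\ge 1$, $B_1,\dots,B_C$ are (nonempty) clopen subsets of $X$ and $h_1,\dots,h_C$ are positive integers; its base is $B=\bigcup_k B_k$. Consider a sequence of CKR partitions $\mathcal P(n)=\{T^{-j}B_k(n):1\le k\le C(n),\ 0\le j<h_k(n)\}$, $n\in\mathbb N$, with bases $B(n)$, where $\mathcal P(0)$ is trivial: $B(0)=X$, $C(0)=1$, $h_1(0)=1$. Properties: (KR1) $B(n+1)\subset B(n)$ for all $n\ge 0$; (KR2) for all $n\ge 0$ every element of $\mathcal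 P(n+1)$ is contained in an element of $\mathcal P(n)$; (KR3) $\bigcap_{n} B(n)$ is a single point; (KR4) the sequence of partitions spans the topology of $X$; (KR5) for all $n\ge1$, $1\le k\le C(n-1)$, $1\le l\le C(n)$ there is $0\le j<h_l(n)$ with $T^{-j}B_l(n)\subset B_k(n-1)$; (KR6) $B(n+1)\subset B_1(n)$ for all $n\in\mathbb N$; (LR) there is $L$ such that $h_l(n)\le L\,h_k(n-1)$ for all $n\ge1$, $1\le l\le C(n)$, $1\le k\le C(n-1)$. A minimal Cantor system $(X,T)$ is linearly recurrent if it has such a sequence satisfying (KR1)-(KR6) and (LR). Such systems are uniquely ergodic. Associated matrices: $M(n)=(m_{l,k}(n);1\le l\le C(n),1\le k\le C(n-1))$, $m_{l,k}(n)=\#\{0\le j<h_l(n):T^{-j}B_l(n)\subset B_k(n-1)\}$. $H(n)=(h_1(n),\dots,h_{C(n)}(n))^t$. For $n>m\ge0$, $P(n,m)=M(n)M(n-1)\cdots M(m+1)$, and $P(n)=P(n,1)$, with $P(1)$ the identity matrix; thus $P(n)H(1)=H(n)$. For $x\in\mathbb R$, $|||x|||$ is the distance from $x$ to the nearest integer; for a real vector $V=(v_1,\dots,v_m)$, $|||V|||=\max_j|||v_j|||$. $\lambda\in\mathbb C$ is an eigenvalue of $(X,T,\mu)$ if there is $f\in L^2(\mu)$, $f\ne0$, with $f\circ T=\lambda f$ $\mu$-a.e.; it is a continuous eigenvalue if there is a continuous $f:X\to\mathbb C$, $f\neq 0$, with $f\circ T=\lambda f$. *)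

theory Defs
  imports "HOL-Probability.Probability" "Jordan_Normal_Form.Matrix"
begin

(* A Cantor space is a nonempty compact metrizable space without isolated points whose topology
   has a countable basis of clopen sets. The space is a whole type; it is Hausdorff by its class,
   and a compact Hausdorff space with a countable basis is metrizable. *)
definition cantor_system :: "('a::t2_space \<Rightarrow> 'a) \<Rightarrow> bool" where
  "cantor_system T \<longleftrightarrow>
     compact (UNIV :: 'a set) \<and>
     (\<exists>\<B> :: 'a set set. countable \<B> \<and> topological_basis \<B> \<and> (\<forall>U\<in>\<B>. open U \<and> closed U)) \<and>
     (\<forall>x :: 'a. \<not> open {x}) \<and>
     (\<exists>S. homeomorphism UNIV UNIV T S)"

definition minimal_cantor_system :: "('a::t2_space \<Rightarrow> 'a) \<Rightarrow> bool" where
  "minimal_cantor_system T \<longleftrightarrow>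
     cantor_system T \<and> (\<forall>F. closed F \<and> T ` F = F \<longrightarrow> F = {} \<or> F = UNIV)"

(* T^{-j} B is a preimage. A single partition is given by the number C of towers, the bases
   B 1, ..., B C and the heights h 1, ..., h C; other values of B and h are irrelevant. *)
definition ckr_atoms :: "('a \<Rightarrow> 'a) \<Rightarrow> nat \<Rightarrow> (nat \<Rightarrow> 'a set) \<Rightarrow> (nat \<Rightarrow> nat) \<Rightarrow> 'a set set" where
  "ckr_atoms T C B h = {(T ^^ j) -` B k | j k. k \<in> {1..C} \<and> j < h k}"

definition ckr_base :: "nat \<Rightarrow> (nat \<Rightarrow> 'a set) \<Rightarrow> 'a set" where
  "ckr_base C B = (\<Union>k\<in>{1..C}. B k)"

(* Injectivity: atoms with different indices (k, j) are different, hence disjoint. *)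
definition ckr_partition ::
  "('a::topological_space \<Rightarrow> 'a) \<Rightarrow> nat \<Rightarrow> (nat \<Rightarrow> 'a set) \<Rightarrow> (nat \<Rightarrow> nat) \<Rightarrow> bool" where
  "ckr_partition T C B h \<longleftrightarrow>
     1 \<le> C \<and>
     (\<forall>k\<in>{1..C}. B k \<noteq> {} \<and> open (B k) \<and> closed (B k) \<and> 0 < h k) \<and>
     inj_on (\<lambda>(k, j). (T ^^ j) -` B k) (SIGMA k:{1..C}. {..<h k}) \<and>
     partition_on UNIV (ckr_atoms T C B h)"

definition ckr_sequence ::
  "('a::topological_space \<Rightarrow> 'a) \<Rightarrow> (nat \<Rightarrow> nat) \<Rightarrow> (nat \<Rightarrow> nat \<Rightarrow> 'a set) \<Rightarrow> (nat \<Rightarrow> nat \<Rightarrow> nat) \<Rightarrow> bool"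
  where
  "ckr_sequence T C B h \<longleftrightarrow>
     (\<forall>n. ckr_partition T (C n) (B n) (h n)) \<and>
     C 0 = 1 \<and> h 0 1 = 1 \<and> ckr_base (C 0) (B 0) = UNIV"

definition KR1 :: "(nat \<Rightarrow> nat) \<Rightarrow> (nat \<Rightarrow> nat \<Rightarrow> 'a set) \<Rightarrow> bool" where
  "KR1 C B \<longleftrightarrow> (\<forall>n. ckr_base (C (Suc n)) (B (Suc n)) \<subseteq> ckr_base (C n) (B n))"

definition KR2 ::
  "('a \<Rightarrow> 'a) \<Rightarrow> (nat \<Rightarrow> nat) \<Rightarrow> (nat \<Rightarrow> nat \<Rightarrow> 'a set) \<Rightarrow> (nat \<Rightarrow> nat \<Rightarrow> nat) \<Rightarrow> bool" where
  "KR2 T C B h \<longleftrightarrow>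
     (\<forall>n. \<forall>A \<in> ckr_atoms T (C (Suc n)) (B (Suc n)) (h (Suc n)).
        \<exists>A' \<in> ckr_atoms T (C n) (B n) (h n). A \<subseteq> A')"

definition KR3 :: "(nat \<Rightarrow> nat) \<Rightarrow> (nat \<Rightarrow> nat \<Rightarrow> 'a set) \<Rightarrow> bool" where
  "KR3 C B \<longleftrightarrow> (\<exists>x. (\<Inter>n. ckr_base (C n) (B n)) = {x})"

definition KR4 :: "('a::topological_space \<Rightarrow> 'a) \<Rightarrow> (nat \<Rightarrow> nat) \<Rightarrow> (nat \<Rightarrow> nat \<Rightarrow> 'a set)
    \<Rightarrow> (nat \<Rightarrow> nat \<Rightarrow> nat) \<Rightarrow> bool" where
  "KR4 T C B h \<longleftrightarrow> topological_basis (\<Union>n. ckr_atoms T (C n) (B n) (h n))"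

definition KR5 ::
  "('a \<Rightarrow> 'a) \<Rightarrow> (nat \<Rightarrow> nat) \<Rightarrow> (nat \<Rightarrow> nat \<Rightarrow> 'a set) \<Rightarrow> (nat \<Rightarrow> nat \<Rightarrow> nat) \<Rightarrow> bool" where
  "KR5 T C B h \<longleftrightarrow>
     (\<forall>n\<ge>1. \<forall>k\<in>{1..C (n - 1)}. \<forall>l\<in>{1..C n}. \<exists>j<h n l. (T ^^ j) -` B n l \<subseteq> B (n - 1) k)"

definition KR6 :: "(nat \<Rightarrow> nat) \<Rightarrow> (nat \<Rightarrow> nat \<Rightarrow> 'a set) \<Rightarrow> bool" where
  "KR6 C B \<longleftrightarrow> (\<forall>n. ckr_base (C (Suc n)) (B (Suc n)) \<subseteq> B n 1)"

definition LR :: "(nat \<Rightarrow> nat) \<Rightarrow> (nat \<Rightarrow> nat \<Rightarrow> nat) \<Rightarrow> bool" where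
  "LR C h \<longleftrightarrow>
     (\<exists>L::real. \<forall>n\<ge>1. \<forall>l\<in>{1..C n}. \<forall>k\<in>{1..C (n - 1)}. real (h n l) \<le> L * real (h (n - 1) k))"

definition linearly_recurrent_sequence ::
  "('a::topological_space \<Rightarrow> 'a) \<Rightarrow> (nat \<Rightarrow> nat) \<Rightarrow> (nat \<Rightarrow> nat \<Rightarrow> 'a set) \<Rightarrow> (nat \<Rightarrow> nat \<Rightarrow> nat) \<Rightarrow> bool"
  where
  "linearly_recurrent_sequence T C B h \<longleftrightarrow>
     ckr_sequence T C B h \<and> KR1 C B \<and> KR2 T C B h \<and> KR3 C B \<and> KR4 T C B h \<and> KR5 T C B h \<and>
     KR6 C B \<and> LR C h"

(* Matrices and vectors are indexed from 0, towers from 1: entry (l, k) belongs to the towers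
   l + 1 of the n-th and k + 1 of the (n - 1)-st partition. Only n \<ge> 1 is meaningful. *)
definition incidence_mat :: "('a \<Rightarrow> 'a) \<Rightarrow> (nat \<Rightarrow> nat) \<Rightarrow> (nat \<Rightarrow> nat \<Rightarrow> 'a set)
    \<Rightarrow> (nat \<Rightarrow> nat \<Rightarrow> nat) \<Rightarrow> nat \<Rightarrow> real mat" where
  "incidence_mat T C B h n =
     mat (C n) (C (n - 1))
       (\<lambda>(l, k). real (card {j. j < h n (Suc l) \<and> (T ^^ j) -` B n (Suc l) \<subseteq> B (n - 1) (Suc k)}))"

definition height_vec :: "(nat \<Rightarrow> nat) \<Rightarrow> (nat \<Rightarrow> nat \<Rightarrow> nat) \<Rightarrow> nat \<Rightarrow> real vec" where
  "height_vec C h n = vec (C n) (\<lambda>l. real (h n (Suc l)))"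

(* incidence_prod T C B h m n is P(n, m) = M(n) M(n - 1) ... M(m + 1) for n > m and the identity
   for n = m; the value for n < m is irrelevant. *)
primrec incidence_prod :: "('a \<Rightarrow> 'a) \<Rightarrow> (nat \<Rightarrow> nat) \<Rightarrow> (nat \<Rightarrow> nat \<Rightarrow> 'a set)
    \<Rightarrow> (nat \<Rightarrow> nat \<Rightarrow> nat) \<Rightarrow> nat \<Rightarrow> nat \<Rightarrow> real mat" where
  "incidence_prod T C B h m 0 = 1\<^sub>m (C m)"
| "incidence_prod T C B h m (Suc n) =
     (if m \<le> n then incidence_mat T C B h (Suc n) * incidence_prod T C B h m n else 1\<^sub>m (C m))"

definition int_dist :: "real \<Rightarrow> real" where
  "int_dist x = \<bar>x - of_int (round x)\<bar>"

definition int_dist_vec :: "real vec \<Rightarrow> real" where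
  "int_dist_vec v = Max (int_dist ` set\<^sub>v v)"

definition invariant_prob_measure :: "('a::topological_space \<Rightarrow> 'a) \<Rightarrow> 'a measure \<Rightarrow> bool" where
  "invariant_prob_measure T \<mu> \<longleftrightarrow> prob_space \<mu> \<and> sets \<mu> = sets borel \<and> distr \<mu> \<mu> T = \<mu>"

definition measurable_eigenvalue :: "('a \<Rightarrow> 'a) \<Rightarrow> 'a measure \<Rightarrow> complex \<Rightarrow> bool" where
  "measurable_eigenvalue T \<mu> c \<longleftrightarrow>
     (\<exists>f :: 'a \<Rightarrow> complex. f \<in> borel_measurable \<mu> \<and> integrable \<mu> (\<lambda>x. (norm (f x))\<^sup>2) \<and>
        \<not> (AE x in \<mu>. f x = 0) \<and> (AE x in \<mu>. f (T x) = c * f x))"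

definition continuous_eigenvalue :: "('a::topological_space \<Rightarrow> 'a) \<Rightarrow> complex \<Rightarrow> bool" where
  "continuous_eigenvalue T c \<longleftrightarrow>
     (\<exists>f :: 'a \<Rightarrow> complex. continuous_on UNIV f \<and> (\<exists>x. f x \<noteq> 0) \<and> (\<forall>x. f (T x) = c * f x))"

end

theory Submission
  imports Defs
begin

text \<open>
  Write \<open>z = 1 / ev\<close> and cut every tower of level \<open>n + 1\<close> into blocks which are towers of level \<open>n\<close>;
  linear recurrence bounds the number of blocks. Since \<open>P(n) H(1) = H(n)\<close>, both series are governed
  by \<open>\<bar>z ^ h n k - 1\<bar>\<close>.

  If these numbers are summable, the functions \<open>x \<mapsto> z ^ r n x\<close>, with \<open>r n x\<close> the time that \<open>x\<close> needs
  to reach the base of level \<open>n\<close>, converge uniformly to a continuous eigenfunction.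

  Conversely let \<open>f\<close> be an eigenfunction and \<open>avg n k\<close> its mean value over the base \<open>B n k\<close>. The
  conditional expectation of \<open>f\<close> given level \<open>n\<close> takes the value \<open>z ^ j * avg n k\<close> on the \<open>j\<close>-th floor
  of tower \<open>k\<close>, and the squared norms of the increments of this martingale are summable. By linear
  recurrence every base has measure at least a constant over its height, so each increment controls
  pointwise the differences \<open>z ^ j * avg (n + 1) l - avg n k\<close> where a block \<open>k\<close> starts on floor \<open>j\<close> of
  tower \<open>l\<close>. Comparing two consecutive blocks bounds \<open>(z ^ h n k - 1) * avg n k\<close>, and the mean values
  stay away from \<open>0\<close>.
\<close>

section \<open>Distance to the integers and roots of unity\<close>

text \<open>Removing the nearest integer from \<open>t\<close> leaves the exponential unchanged, and
  a chord of the unit circle has length twice the sine of half its angle.\<close>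

lemma norm_exp_2pi_i:
  "norm (exp (2 * \<i> * complex_of_real pi * complex_of_real t) - 1) = 2 * \<bar>sin (pi * (t - of_int (round t)))\<bar>"
proof -
  have "exp (2 * \<i> * complex_of_real pi * complex_of_real t)
      = exp (2 * \<i> * complex_of_real pi * complex_of_real t - 2 * \<i> * complex_of_real pi * of_int (round t))"
    using exp_2pi_1_int[of "round t"] by (simp add: exp_diff mult_ac)
  also have "\<dots> = exp (\<i> * of_real (2 * (pi * (t - of_int (round t)))))"
    by (simp add: algebra_simps)
  finally show ?thesis by (simp only: dist_exp_i_1) simp
qed

lemma norm_exp_2pi_i_le:
  "norm (exp (2 * \<i> * complex_of_real pi * complex_of_real t) - 1) \<le> 2 * pi * int_dist t"
proof -
  have "\<bar>sin (pi * (t - of_int (round t)))\<bar> \<le> \<bar>pi * (t - of_int (round t))\<bar>"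
    by (rule abs_sin_x_le_abs_x)
  then show ?thesis by (simp add: norm_exp_2pi_i int_dist_def abs_mult)
qed

lemma int_dist_le_norm_exp:
  "int_dist t \<le> norm (exp (2 * \<i> * complex_of_real pi * complex_of_real t) - 1)"
proof -
  define u where "u = \<bar>t - of_int (round t)\<bar>"
  have u: "0 \<le> u" "u \<le> 1 / 2"
    using of_int_round_abs_le[of t] by (auto simp: u_def abs_minus_commute)
  \<comment> \<open>Up to \<open>pi / 3\<close> the derivative \<open>cos x - 1 / 2\<close> is
    nonnegative, so \<open>sin x\<close> stays above \<open>x / 2\<close>. Beyond it the sine is at
    least \<open>1 / 2\<close>, and \<open>u\<close> is at most \<open>1 / 2\<close>.\<close>
  have "u \<le> 2 * sin (pi * u)"
  proof (cases "pi * u \<le> pi / 3")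
    case True
    have "sin 0 - 0 / 2 \<le> sin (pi * u) - pi * u / 2"
    proof (rule DERIV_nonneg_imp_nondecreasing[of 0 "pi * u" "\<lambda>x. sin x - x / 2"])
      show "0 \<le> pi * u" using u by simp
      fix x assume x: "0 \<le> x" "x \<le> pi * u"
      have "cos x \<ge> cos (pi / 3)"
        using x(1) order_trans[OF x(2) True] pi_gt_zero by (intro cos_monotone_0_pi_le) auto
      then show "\<exists>y. ((\<lambda>x. sin x - x / 2) has_real_derivative y) (at x) \<and> 0 \<le> y"
        by (intro exI[of _ "cos x - 1 / 2"]) (auto intro!: derivative_eq_intros simp: cos_60)
    qed
    moreover have "u \<le> pi * u" using u pi_gt3 by (intro mult_le_cancel_right1[THEN iffD2]) auto
    ultimately show ?thesis by simp
  next
    case False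
    have "pi * u \<le> pi / 2" using u by simp
    then have "sin (pi / 3) \<le> sin (pi * u)"
      using False pi_gt_zero by (intro sin_monotone_2pi_le) linarith+
    moreover have "1 / 2 \<le> sin (pi / 3)" by (simp add: sin_60)
    ultimately show ?thesis using u by simp
  qed
  also have "2 * sin (pi * u) \<le> 2 * \<bar>sin (pi * (t - of_int (round t)))\<bar>"
    by (cases "t - of_int (round t) \<ge> 0") (auto simp: u_def right_diff_distrib sin_diff)
  finally show ?thesis by (simp add: norm_exp_2pi_i u_def int_dist_def)
qed

lemma int_dist_vec_ge:
  assumes "i < dim_vec v"
  shows "int_dist (v $ i) \<le> int_dist_vec v"
  unfolding int_dist_vec_def using assms by (intro Max_ge) (auto simp: vec_set_def)

lemma int_dist_vec_attained:
  assumes "0 < dim_vec v"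
  obtains i where "i < dim_vec v" "int_dist_vec v = int_dist (v $ i)"
proof -
  have "int_dist_vec v \<in> int_dist ` set\<^sub>v v"
    unfolding int_dist_vec_def using assms by (intro Max_in) (auto simp: vec_set_def)
  then show thesis using that by (auto simp: vec_set_def)
qed

section \<open>A variance identity and norm inequalities for powers\<close>

text \<open>The hypothesis says without division that \<open>c\<close> is the weighted mean, so
  after expanding the square the cross term is minus twice the term in
  \<open>norm c\<close>.\<close>

lemma sum_weighted_variance:
  fixes w :: "'i \<Rightarrow> real" and z :: "'i \<Rightarrow> complex"
  assumes "(\<Sum>i\<in>S. of_real (w i) * z i) = of_real (\<Sum>i\<in>S. w i) * c"
  shows "(\<Sum>i\<in>S. w i * (norm (z i - c))\<^sup>2) = (\<Sum>i\<in>S. w i * (norm (z i))\<^sup>2) - (\<Sum>i\<in>S. w i) * (norm c)\<^sup>2"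
proof -
  have eq: "(norm (z i - c))\<^sup>2 = (norm (z i))\<^sup>2 - 2 * Re (z i * cnj c) + (norm c)\<^sup>2" for i
    unfolding cmod_power2 by (simp add: power2_eq_square algebra_simps)
  have "(\<Sum>i\<in>S. w i * Re (z i * cnj c)) = Re ((\<Sum>i\<in>S. of_real (w i) * z i) * cnj c)"
    by (simp add: sum_distrib_right sum_distrib_left sum.distrib algebra_simps)
  also have "\<dots> = (\<Sum>i\<in>S. w i) * (norm c)\<^sup>2"
    unfolding assms cmod_power2 by (simp add: power2_eq_square algebra_simps)
  finally have *: "(\<Sum>i\<in>S. w i * Re (z i * cnj c)) = (\<Sum>i\<in>S. w i) * (norm c)\<^sup>2" .
  have "(\<Sum>i\<in>S. w i * (norm (z i - c))\<^sup>2) =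
    (\<Sum>i\<in>S. w i * (norm (z i))\<^sup>2) - 2 * (\<Sum>i\<in>S. w i * Re (z i * cnj c)) + (\<Sum>i\<in>S. w i) * (norm c)\<^sup>2"
    unfolding eq by (simp add: algebra_simps sum.distrib sum_subtractf sum_distrib_left sum_distrib_right)
  then show ?thesis using * by simp
qed

text \<open>Heights of stacked blocks add; this makes their distances from \<open>1\<close> add as
  well.\<close>

lemma norm_power_diff_one_triangle:
  fixes z :: "'b::real_normed_field"
  assumes "norm z = 1"
  shows "norm (z ^ (m + n) - 1) \<le> norm (z ^ m - 1) + norm (z ^ n - 1)"
proof -
  have "z ^ (m + n) - 1 = z ^ m * (z ^ n - 1) + (z ^ m - 1)"
    by (simp add: power_add algebra_simps)
  then have "norm (z ^ (m + n) - 1) \<le> norm (z ^ m * (z ^ n - 1)) + norm (z ^ m - 1)"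
    by (metis norm_triangle_ineq)
  then show ?thesis using assms by (simp add: norm_mult norm_power)
qed

lemma norm_inverse_power_minus_one:
  fixes a :: "'b::real_normed_field"
  assumes "norm a = 1"
  shows "norm (inverse a ^ m - 1) = norm (a ^ m - 1)"
proof -
  have "a \<noteq> 0" using assms by auto
  then have "inverse a ^ m - 1 = inverse (a ^ m) * (1 - a ^ m)"
    by (simp add: right_diff_distrib power_inverse)
  then show ?thesis using assms by (simp add: norm_mult norm_inverse norm_power norm_minus_commute)
qed

section \<open>Integrals over preimages and over a basis\<close>

text \<open>Dynkin's argument: with the empty set added, the basis is an intersection-stable
  generator of the Borel sets, so the integral vanishes over each of them. The real and imaginary
  parts are then compared with the density \<open>0\<close>.\<close>

lemma AE_eq_0_if_integral_basis_eq_0: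
  fixes f :: "'a::t2_space \<Rightarrow> complex"
  assumes sets: "sets M = sets borel" and f: "integrable M f"
    and basis: "countable \<B>" "topological_basis \<B>"
    and Int: "\<And>U V. U \<in> \<B> \<Longrightarrow> V \<in> \<B> \<Longrightarrow> U \<inter> V \<in> insert {} \<B>"
    and zero: "\<And>U. U \<in> insert UNIV \<B> \<Longrightarrow> (LINT x:U|M. f x) = 0"
  shows "AE x in M. f x = 0"
proof -
  have space: "space M = UNIV" using sets_eq_imp_space_eq[OF sets] by simp
  have "sets M = sigma_sets UNIV \<B>"
    unfolding sets borel_eq_countable_basis[OF basis] by simp
  also have "\<dots> = sigma_sets UNIV (insert {} \<B>)"
    by (intro sigma_sets_eqI) (auto intro: sigma_sets.intros)
  finally have gen: "sets M = sigma_sets UNIV (insert {} \<B>)" .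
  have integ: "set_integrable M A f" if "A \<in> sets M" for A
    using integrable_mult_indicator[OF that f] by (simp add: set_integrable_def)
  have "U \<inter> V \<in> insert {} \<B>" if "U \<in> insert {} \<B>" "V \<in> insert {} \<B>" for U V
    using that Int by blast
  then have "Int_stable (insert {} \<B>)" unfolding Int_stable_def by blast
  moreover have "insert {} \<B> \<subseteq> Pow UNIV" by blast
  ultimately have "(LINT x:A|M. f x) = 0" if "A \<in> sigma_sets UNIV (insert {} \<B>)" for A
    using that
  proof (induction rule: sigma_sets_induct_disjoint)
    case (basic A)
    then consider "A = {}" | "A \<in> \<B>" by blast
    then show ?case
    proof cases
      case 2
      then show ?thesis by (intro zero) blast
    qed (simp add: set_lebesgue_integral_def)
  next
    case empty
    then show ?case by (simp add: set_lebesgue_integral_def)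
  next
    case (compl A)
    have A: "A \<in> sets M" unfolding gen by (rule compl.hyps)
    then have A': "UNIV - A \<in> sets M" using sets.compl_sets[of A M] unfolding space by blast
    \<comment> \<open>Complements are where the vanishing integral over \<open>UNIV\<close> enters;
      a basis need not contain the whole space.\<close>
    have "(LINT x:A \<union> (UNIV - A)|M. f x) = (LINT x:A|M. f x) + (LINT x:UNIV - A|M. f x)"
      by (intro set_integral_Un integ A A') simp
    moreover have "A \<union> (UNIV - A) = UNIV" by blast
    ultimately show ?case using compl.IH zero[of UNIV] by simp
  next
    case (union A)
    have A: "A i \<in> sets M" for i unfolding gen using union.hyps(2) by blast
    have "(LINT x:\<Union> (range A)|M. f x) = (\<Sum>i. LINT x:A i|M. f x)"
    proof (rule lebesgue_integral_countable_add)
      show "A i \<inter> A j = {}" if "i \<noteq> j" for i j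
        using disjoint_family_onD[OF union.hyps(1)] that by simp
      show "set_integrable M (\<Union> (range A)) f" using A by (intro integ sets.countable_UN) blast
    qed (rule A)
    then show ?case using union.IH by simp
  qed
  then have null: "(LINT x:A|M. f x) = 0" if "A \<in> sets M" for A using that unfolding gen by blast
  have "AE x in M. Re (f x) = 0"
  proof (rule density_unique_real)
    fix A assume A: "A \<in> sets M"
    have "(LINT x:A|M. Re (f x)) = Re (LINT x:A|M. f x)"
      using integ[OF A] unfolding set_lebesgue_integral_def set_integrable_def by (subst integral_Re[symmetric]) auto
    then show "(LINT x:A|M. Re (f x)) = (LINT x:A|M. 0)" using null[OF A] by simp
  qed (use f in auto)
  moreover have "AE x in M. Im (f x) = 0"
  proof (rule density_unique_real)
    fix A assume A: "A \<in> sets M"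
    have "(LINT x:A|M. Im (f x)) = Im (LINT x:A|M. f x)"
      using integ[OF A] unfolding set_lebesgue_integral_def set_integrable_def by (subst integral_Im[symmetric]) auto
    then show "(LINT x:A|M. Im (f x)) = (LINT x:A|M. 0)" using null[OF A] by simp
  qed (use f in auto)
  ultimately show ?thesis by eventually_elim (simp add: complex_eq_iff)
qed

text \<open>Each preimage under \<open>T\<close> costs one factor \<open>z\<close>: replace
  \<open>g x\<close> by \<open>z * g (T x)\<close> and change variables under the invariant
  measure.\<close>

lemma set_integral_funpow_vimage:
  fixes g :: "'a \<Rightarrow> 'b::{banach, second_countable_topology, real_normed_field}"
  assumes T: "T \<in> measurable M M" and inv: "distr M M T = M"
    and g: "integrable M g" "AE x in M. g x = z * g (T x)"
    and A: "A \<in> sets M"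
  shows "(LINT x:(T ^^ j) -` A \<inter> space M|M. g x) = z ^ j * (LINT x:A|M. g x)"
  using A
proof (induction j arbitrary: A)
  case 0
  then show ?case using sets.sets_into_space by (simp add: Int_absorb2 id_def)
next
  case (Suc j)
  have TA: "T -` A \<inter> space M \<in> sets M" using T Suc.prems by measurable
  have "(T ^^ Suc j) -` A \<inter> space M = (T ^^ j) -` (T -` A \<inter> space M) \<inter> space M"
    using measurable_space[OF measurable_compose_n[OF T]] by auto
  then have "(LINT x:(T ^^ Suc j) -` A \<inter> space M|M. g x) = z ^ j * (LINT x:T -` A \<inter> space M|M. g x)"
    using Suc.IH[OF TA] by simp
  also have "(LINT x:T -` A \<inter> space M|M. g x) = (LINT x|M. z * (indicator A (T x) *\<^sub>R g (T x)))"
    unfolding set_lebesgue_integral_def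
  proof (rule integral_cong_AE)
    show "AE x in M. indicator (T -` A \<inter> space M) x *\<^sub>R g x = z * (indicator A (T x) *\<^sub>R g (T x))"
      using g(2) AE_space by eventually_elim (auto simp: indicator_def)
  qed (use g(1) T Suc.prems TA in measurable)
  also have "\<dots> = z * (LINT x|M. indicator A (T x) *\<^sub>R g (T x))"
    by (rule integral_mult_right_zero)
  also have "(LINT x|M. indicator A (T x) *\<^sub>R g (T x)) = (LINT x|distr M M T. indicator A x *\<^sub>R g x)"
    using g(1) T Suc.prems by (subst integral_distr) auto
  also have "\<dots> = (LINT x:A|M. g x)" by (simp add: inv set_lebesgue_integral_def)
  finally show ?case by (simp add: mult_ac)
qed

section \<open>Blocks of a tower\<close>

text \<open>\<open>L\<close> is the constant of \<open>LR\<close>, fixed so that all bounds share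
  it. Surjectivity of \<open>T\<close> puts a point on every floor.\<close>

locale lr_towers =
  fixes T :: "'a::t2_space \<Rightarrow> 'a"
    and C :: "nat \<Rightarrow> nat" and B :: "nat \<Rightarrow> nat \<Rightarrow> 'a set" and h :: "nat \<Rightarrow> nat \<Rightarrow> nat"
    and L :: real
  assumes surj_T: "surj T"
    and partition: "ckr_partition T (C n) (B n) (h n)"
    and KR2: "KR2 T C B h" and KR5: "KR5 T C B h" and KR6: "KR6 C B"
    and height_le: "l \<in> {1..C (Suc n)} \<Longrightarrow> k \<in> {1..C n} \<Longrightarrow> real (h (Suc n) l) \<le> L * real (h n k)"
begin

text \<open>Floor \<open>j\<close> is a \<open>j\<close>-fold preimage of the base, so
  \<open>T\<close> moves down a tower. The set lists the floors of tower \<open>l\<close> on which a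
  block of type \<open>k\<close> starts; its size is the incidence entry.\<close>

definition visits :: "nat \<Rightarrow> nat \<Rightarrow> nat \<Rightarrow> nat set" where
  "visits n l k = {j. j < h (Suc n) l \<and> (T ^^ j) -` B (Suc n) l \<subseteq> B n k}"

lemma finite_visits [simp]: "finite (visits n l k)"
  by (simp add: visits_def)

lemma one_index: "1 \<in> {1..C n}"
  using partition[of n] by (simp add: ckr_partition_def)

lemma height_pos: "k \<in> {1..C n} \<Longrightarrow> 0 < h n k"
  and clopen_base: "k \<in> {1..C n} \<Longrightarrow> open (B n k)" "k \<in> {1..C n} \<Longrightarrow> closed (B n k)"
  using partition[of n] by (auto simp: ckr_partition_def)

lemma surj_funpow: "surj (T ^^ j)"
proof (induction j)
  case (Suc j)
  then show ?case using comp_surj[OF Suc surj_T] by simp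
qed simp

lemma tower_point:
  assumes "k \<in> {1..C n}"
  obtains x where "(T ^^ j) x \<in> B n k"
proof -
  have "B n k \<noteq> {}"
    using partition[of n] assms unfolding ckr_partition_def by blast
  then obtain y where "y \<in> B n k" by blast
  then show thesis
    using that surjD[OF surj_funpow, of y j] by auto
qed

lemma tower_ex:
  obtains k j where "k \<in> {1..C n}" "j < h n k" "(T ^^ j) x \<in> B n k"
proof -
  have "x \<in> \<Union> (ckr_atoms T (C n) (B n) (h n))"
    using partition[of n] by (auto simp: ckr_partition_def partition_on_def)
  then show thesis
    using that by (auto simp: ckr_atoms_def)
qed

text \<open>Disjointness of atoms makes the two floors equal as sets; the injectivity clause of
  \<open>ckr_partition\<close> turns this into equality of indices.\<close>

lemma tower_unique:
  assumes "k \<in> {1..C n}" "j < h n k" "(T ^^ j) x \<in> B n k"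
    and "k' \<in> {1..C n}" "j' < h n k'" "(T ^^ j') x \<in> B n k'"
  shows "k = k' \<and> j = j'"
proof -
  let ?A = "(T ^^ j) -` B n k" and ?A' = "(T ^^ j') -` B n k'"
  have "disjoint (ckr_atoms T (C n) (B n) (h n))"
    using partition[of n] by (auto simp: ckr_partition_def partition_on_def)
  moreover have "?A \<in> ckr_atoms T (C n) (B n) (h n)" "?A' \<in> ckr_atoms T (C n) (B n) (h n)"
    using assms unfolding ckr_atoms_def by blast+
  moreover have "x \<in> ?A \<inter> ?A'" using assms(3,6) by simp
  ultimately have "?A = ?A'"
    unfolding disjoint_def by (metis emptyE)
  moreover have "inj_on (\<lambda>(k, j). (T ^^ j) -` B n k) (SIGMA k:{1..C n}. {..<h n k})"
    using partition[of n] by (auto simp: ckr_partition_def)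
  moreover have "(k, j) \<in> (SIGMA k:{1..C n}. {..<h n k})" "(k', j') \<in> (SIGMA k:{1..C n}. {..<h n k})"
    using assms(1,2,4,5) by simp_all
  ultimately have "(k, j) = (k', j')"
    by (metis (mono_tags, lifting) inj_on_eq_iff case_prod_conv)
  then show ?thesis by simp
qed

lemma base_level_zero:
  assumes "k \<in> {1..C n}" "j < h n k" "(T ^^ j) x \<in> B n k" "k' \<in> {1..C n}" "x \<in> B n k'"
  shows "k = k' \<and> j = 0"
  using tower_unique[OF assms(1-4), of 0] assms height_pos by auto

text \<open>\<open>T x\<close> lies on floor \<open>i\<close>. Were this not the top floor,
  \<open>x\<close> would lie on floor \<open>Suc i\<close> of the same tower and not in a
  base.\<close>

lemma above_base_top:
  assumes "k' \<in> {1..C n}" "x \<in> B n k'" "k \<in> {1..C n}" "i < h n k" "(T ^^ Suc i) x \<in> B n k"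
  shows "Suc i = h n k"
  using base_level_zero[OF assms(3) _ assms(5,1,2)] assms(4) by (cases "Suc i < h n k") auto

text \<open>If \<open>x\<close> lay on a positive floor, \<open>T x\<close> would lie one floor
  lower in that tower, but also on the top floor of tower \<open>k\<close>; so \<open>x\<close>
  would be on the nonexistent floor \<open>h n k\<close>.\<close>

lemma return_to_base:
  assumes k: "k \<in> {1..C n}" and x: "(T ^^ h n k) x \<in> B n k"
  obtains k' where "k' \<in> {1..C n}" "x \<in> B n k'"
proof -
  obtain k' j where k': "k' \<in> {1..C n}" "j < h n k'" "(T ^^ j) x \<in> B n k'"
    by (rule tower_ex)
  have "j = 0"
  proof (rule ccontr)
    assume "j \<noteq> 0"
    then obtain i where i: "j = Suc i" by (cases j) auto
    obtain m where m: "h n k = Suc m" using height_pos[OF k] by (cases "h n k") auto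
    have "k' = k \<and> i = m"
      using k' k x i m by (intro tower_unique[of k' n i "T x" k m]) (auto simp: funpow_swap1)
    then show False using k' i m by simp
  qed
  then show thesis using that k' by auto
qed

text \<open>The level of a point is its entry time to the base.\<close>
lemma level_le_hit:
  assumes "k \<in> {1..C n}" "j < h n k" "(T ^^ j) x \<in> B n k" "k' \<in> {1..C n}" "(T ^^ m) x \<in> B n k'"
  shows "j \<le> m"
proof (rule ccontr)
  assume "\<not> j \<le> m"
  then have "(T ^^ (j - m)) ((T ^^ m) x) \<in> B n k"
    using assms(3) by (simp flip: funpow_add[unfolded comp_def, THEN fun_cong])
  then have "j - m = 0"
    using base_level_zero[of k n "j - m" "(T ^^ m) x" k'] assms by auto
  then show False using \<open>\<not> j \<le> m\<close> by simp
qed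

lemma base_subset:
  assumes "l \<in> {1..C (Suc n)}"
  shows "B (Suc n) l \<subseteq> B n 1"
  using KR6 assms unfolding KR6_def ckr_base_def by blast

text \<open>\<open>KR2\<close> puts floor \<open>j\<close> into some floor \<open>i\<close> of a
  tower \<open>k\<close>; moving down \<open>i\<close> floors gives the start of the surrounding
  block.\<close>

lemma tower_refines:
  assumes l: "l \<in> {1..C (Suc n)}" and j: "j < h (Suc n) l"
  obtains k i where "k \<in> {1..C n}" "i < h n k" "i \<le> j"
    "(T ^^ j) -` B (Suc n) l \<subseteq> (T ^^ i) -` B n k" "j - i \<in> visits n l k"
proof -
  have "(T ^^ j) -` B (Suc n) l \<in> ckr_atoms T (C (Suc n)) (B (Suc n)) (h (Suc n))"
    using assms unfolding ckr_atoms_def by blast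
  then obtain k i where ki: "k \<in> {1..C n}" "i < h n k"
    and sub: "(T ^^ j) -` B (Suc n) l \<subseteq> (T ^^ i) -` B n k"
    using KR2 unfolding KR2_def ckr_atoms_def by (smt (verit) mem_Collect_eq)
  obtain x where x: "(T ^^ j) x \<in> B (Suc n) l" by (rule tower_point[OF l])
  \<comment> \<open>By \<open>KR6\<close> a point of floor \<open>j\<close> is in a base of level
    \<open>n\<close> after \<open>j\<close> steps, and \<open>i\<close> is its first such
    time.\<close>
  have "i \<le> j"
    using level_le_hit[OF ki _ one_index, of x j] x sub base_subset[OF l] by blast
  \<comment> \<open>The inclusion between preimages descends because \<open>T ^^ i\<close> is
    surjective.\<close>
  moreover have "(T ^^ (j - i)) -` B (Suc n) l \<subseteq> B n k"
  proof
    fix y assume "y \<in> (T ^^ (j - i)) -` B (Suc n) l"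
    moreover obtain z where "y = (T ^^ i) z" using surjD[OF surj_funpow, of y i] by blast
    ultimately have "(T ^^ j) z \<in> B (Suc n) l"
      using \<open>i \<le> j\<close> by (simp flip: funpow_add[unfolded comp_def, THEN fun_cong])
    then show "y \<in> B n k" using sub \<open>y = _\<close> by blast
  qed
  ultimately show thesis
    using that[OF ki _ sub] j by (auto simp: visits_def)
qed

lemma visits_hit:
  assumes "j \<in> visits n l k" "(T ^^ (j + i)) x \<in> B (Suc n) l"
  shows "(T ^^ i) x \<in> B n k"
  using assms by (auto simp: visits_def funpow_add)

lemma visits_unique:
  assumes "l \<in> {1..C (Suc n)}" "k \<in> {1..C n}" "k' \<in> {1..C n}" "i < h n k" "i' < h n k'"
    and "j \<in> visits n l k" "j' \<in> visits n l k'" "j + i = j' + i'"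
  shows "k = k' \<and> j = j' \<and> i = i'"
proof -
  obtain x where x: "(T ^^ (j + i)) x \<in> B (Suc n) l" by (rule tower_point[OF assms(1)])
  have "k = k' \<and> i = i'"
    using tower_unique[OF assms(2,4) visits_hit[OF assms(6) x] assms(3,5) visits_hit[OF assms(7)]]
      x assms(8) by simp
  then show ?thesis using assms by simp
qed

text \<open>Otherwise a point just above the top of tower \<open>l\<close> would lie on a positive
  floor of the block, although it is in a base of level \<open>n + 1\<close>, hence of level
  \<open>n\<close>.\<close>

lemma visits_fit:
  assumes l: "l \<in> {1..C (Suc n)}" and k: "k \<in> {1..C n}" and j: "j \<in> visits n l k"
  shows "j + h n k \<le> h (Suc n) l"
proof (rule ccontr)
  assume "\<not> ?thesis"
  moreover have jl: "j < h (Suc n) l" using j by (simp add: visits_def)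
  ultimately obtain i where i: "h (Suc n) l = j + i" "0 < i" "i < h n k"
    by (metis add_less_cancel_left le_add_diff_inverse less_imp_le_nat linorder_not_less zero_less_diff)
  obtain x where x: "(T ^^ (h (Suc n) l)) x \<in> B (Suc n) l" by (rule tower_point[OF l])
  obtain l' where "l' \<in> {1..C (Suc n)}" "x \<in> B (Suc n) l'" by (rule return_to_base[OF l x])
  then have "x \<in> B n 1" using base_subset by blast
  moreover have "(T ^^ i) x \<in> B n k" using x i visits_hit[OF j] by simp
  ultimately show False using base_level_zero[OF k i(3) _ one_index] i by auto
qed

lemma visits_zero: "l \<in> {1..C (Suc n)} \<Longrightarrow> 0 \<in> visits n l 1"
  using base_subset height_pos by (auto simp: visits_def)

lemma visits_nonempty:
  assumes "l \<in> {1..C (Suc n)}" "k \<in> {1..C n}"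
  obtains j where "j \<in> visits n l k"
  using KR5[unfolded KR5_def, rule_format, of "Suc n" k l] assms by (auto simp: visits_def)

text \<open>By \<open>return_to_base\<close> the points just above a block lie in bases of level
  \<open>n\<close>, so that floor has offset \<open>0\<close> in its own block.\<close>

lemma visits_next:
  assumes l: "l \<in> {1..C (Suc n)}" and k: "k \<in> {1..C n}" and j: "j \<in> visits n l k"
    and less: "j + h n k < h (Suc n) l"
  obtains k' where "k' \<in> {1..C n}" "j + h n k \<in> visits n l k'"
proof -
  obtain k' i where k': "k' \<in> {1..C n}" "i < h n k'" "i \<le> j + h n k"
    and sub: "(T ^^ (j + h n k)) -` B (Suc n) l \<subseteq> (T ^^ i) -` B n k'"
    and vis: "j + h n k - i \<in> visits n l k'"
    by (rule tower_refines[OF l less])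
  obtain x where x: "(T ^^ (j + h n k)) x \<in> B (Suc n) l" by (rule tower_point[OF l])
  then have "(T ^^ h n k) x \<in> B n k" by (rule visits_hit[OF j])
  then obtain k'' where "k'' \<in> {1..C n}" "x \<in> B n k''" by (rule return_to_base[OF k])
  then have "i = 0" using base_level_zero[OF k'(1,2)] x sub by blast
  then show thesis using that k' vis by simp
qed

text \<open>Floor \<open>j - 1\<close> belongs to some block. A point of floor \<open>j\<close> lies
  in a base, so \<open>T\<close> sends it to the top floor of that block, which therefore ends just
  below \<open>j\<close>.\<close>

lemma visits_prev:
  assumes l: "l \<in> {1..C (Suc n)}" and k: "k \<in> {1..C n}" and j: "j \<in> visits n l k" and "0 < j"
  obtains k' j' where "k' \<in> {1..C n}" "j' \<in> visits n l k'" "j = j' + h n k'"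
proof -
  have "j < h (Suc n) l" using j by (simp add: visits_def)
  then obtain k' i where k': "k' \<in> {1..C n}" "i < h n k'" "i \<le> j - 1"
    and sub: "(T ^^ (j - 1)) -` B (Suc n) l \<subseteq> (T ^^ i) -` B n k'"
    and vis: "j - 1 - i \<in> visits n l k'"
    by (rule tower_refines[OF l less_imp_diff_less])
  obtain x where x: "(T ^^ j) x \<in> B (Suc n) l" by (rule tower_point[OF l])
  then have "T x \<in> (T ^^ (j - 1)) -` B (Suc n) l"
    using \<open>0 < j\<close> by (cases j) (auto simp: funpow_swap1)
  then have "(T ^^ Suc i) x \<in> B n k'" using sub by (auto simp: funpow_swap1)
  moreover have "x \<in> B n k" using visits_hit[OF j, of 0 x] x by simp
  ultimately have "Suc i = h n k'" using above_base_top k k' by blast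
  then show thesis using that[OF k'(1) vis] k' \<open>0 < j\<close> by simp
qed

text \<open>A floor is encoded by the block containing it and its position there: blocks are
  disjoint, fit into the tower (\<open>visits_fit\<close>) and cover it
  (\<open>tower_refines\<close>).\<close>

lemma bij_betw_visits:
  assumes l: "l \<in> {1..C (Suc n)}"
  shows "bij_betw (\<lambda>(k, j, i). j + i) (SIGMA k:{1..C n}. visits n l k \<times> {..<h n k}) {..<h (Suc n) l}"
  unfolding bij_betw_def
proof (intro conjI equalityI subsetI)
  show "inj_on (\<lambda>(k, j, i). j + i) (SIGMA k:{1..C n}. visits n l k \<times> {..<h n k})"
  proof (rule inj_onI, clarify)
    fix k j i k' j' i'
    assume "k \<in> {1..C n}" "j \<in> visits n l k" "i < h n k" "k' \<in> {1..C n}" "j' \<in> visits n l k'"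
      "i' < h n k'" "j + i = j' + i'"
    then show "k = k' \<and> (j, i) = (j', i')" using visits_unique[OF l, of k k' i i' j j'] by simp
  qed
  fix m assume "m \<in> (\<lambda>(k, j, i). j + i) ` (SIGMA k:{1..C n}. visits n l k \<times> {..<h n k})"
  then obtain k j i where "k \<in> {1..C n}" "j \<in> visits n l k" "i < h n k" "m = j + i" by auto
  then show "m \<in> {..<h (Suc n) l}" using visits_fit[OF l, of k j] by simp
next
  fix m assume "m \<in> {..<h (Suc n) l}"
  then have m: "m < h (Suc n) l" by simp
  obtain k i where "k \<in> {1..C n}" "i < h n k" "i \<le> m" "m - i \<in> visits n l k"
    by (rule tower_refines[OF l m])
  then show "m \<in> (\<lambda>(k, j, i). j + i) ` (SIGMA k:{1..C n}. visits n l k \<times> {..<h n k})"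
    by (intro image_eqI[of _ _ "(k, m - i, i)"]) auto
qed

lemma height_Suc:
  assumes l: "l \<in> {1..C (Suc n)}"
  shows "h (Suc n) l = (\<Sum>k\<in>{1..C n}. card (visits n l k) * h n k)"
  using bij_betw_same_card[OF bij_betw_visits[OF l]] by (simp add: card_cartesian_product)

text \<open>Each block has at least the fraction \<open>1 / L\<close> of the height of the tower,
  and the block heights add up to that height.\<close>

lemma card_visits_le:
  assumes l: "l \<in> {1..C (Suc n)}"
  shows "(\<Sum>k\<in>{1..C n}. real (card (visits n l k))) \<le> L"
proof -
  have "real (h (Suc n) l) * (\<Sum>k\<in>{1..C n}. real (card (visits n l k)))
    = (\<Sum>k\<in>{1..C n}. real (card (visits n l k)) * real (h (Suc n) l))"
    by (simp add: sum_distrib_left mult.commute)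
  also have "\<dots> \<le> (\<Sum>k\<in>{1..C n}. real (card (visits n l k)) * (L * real (h n k)))"
    using height_le[OF l] by (intro sum_mono mult_left_mono) auto
  also have "\<dots> = real (h (Suc n) l) * L"
    by (subst height_Suc[OF l]) (simp add: sum_distrib_left mult_ac)
  finally show ?thesis using height_pos[OF l] by simp
qed

text \<open>The floor of level \<open>n + 1\<close> through a point of \<open>B n k\<close> lies
  inside one floor of level \<open>n\<close>, which must be this base.\<close>

lemma base_decomp:
  assumes k: "k \<in> {1..C n}"
  shows "B n k = (\<Union>(l, j)\<in>(SIGMA l:{1..C (Suc n)}. visits n l k). (T ^^ j) -` B (Suc n) l)"
proof (intro equalityI subsetI)
  fix x assume x: "x \<in> B n k"
  obtain l j where l: "l \<in> {1..C (Suc n)}" "j < h (Suc n) l" "(T ^^ j) x \<in> B (Suc n) l"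
    by (rule tower_ex)
  obtain k' i where k': "k' \<in> {1..C n}" "i < h n k'"
    and "(T ^^ j) -` B (Suc n) l \<subseteq> (T ^^ i) -` B n k'" "j - i \<in> visits n l k'"
    by (rule tower_refines[OF l(1,2)])
  moreover from this have "k' = k \<and> i = 0" using base_level_zero[OF k' _ k x] l by auto
  ultimately show "x \<in> (\<Union>(l, j)\<in>(SIGMA l:{1..C (Suc n)}. visits n l k). (T ^^ j) -` B (Suc n) l)"
    using l by auto
qed (auto simp: visits_def)

lemma disjoint_tower_levels:
  "disjoint_family_on (\<lambda>(k, j). (T ^^ j) -` B n k) (SIGMA k:{1..C n}. {..<h n k})"
  unfolding disjoint_family_on_def
proof (intro ballI impI)
  fix p q assume pq: "p \<in> (SIGMA k:{1..C n}. {..<h n k})" "q \<in> (SIGMA k:{1..C n}. {..<h n k})" "p \<noteq> q"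
  obtain k j k' j' where "p = (k, j)" "q = (k', j')" by (metis surj_pair)
  moreover have "False" if "x \<in> (T ^^ j) -` B n k" "x \<in> (T ^^ j') -` B n k'" for x
    using tower_unique[of k n j x k' j'] that pq calculation by simp
  ultimately show "(case p of (k, j) \<Rightarrow> (T ^^ j) -` B n k) \<inter> (case q of (k, j) \<Rightarrow> (T ^^ j) -` B n k) = {}"
    by auto
qed

lemma UNIV_decomp: "(\<Union>(k, j)\<in>(SIGMA k:{1..C n}. {..<h n k}). (T ^^ j) -` B n k) = UNIV"
proof (intro equalityI subsetI)
  fix x
  obtain k j where "k \<in> {1..C n}" "j < h n k" "(T ^^ j) x \<in> B n k" by (rule tower_ex)
  then show "x \<in> (\<Union>(k, j)\<in>(SIGMA k:{1..C n}. {..<h n k}). (T ^^ j) -` B n k)" by auto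
qed auto

section \<open>Incidence matrices and height vectors\<close>

lemma incidence_mat_mult_height_vec:
  "incidence_mat T C B h (Suc n) *\<^sub>v height_vec C h n = height_vec C h (Suc n)"
proof (rule eq_vecI)
  fix l assume "l < dim_vec (height_vec C h (Suc n))"
  then have l: "l < C (Suc n)" by (simp add: height_vec_def)
  have "(incidence_mat T C B h (Suc n) *\<^sub>v height_vec C h n) $ l
      = (\<Sum>k = 0..<C n. real (card (visits n (Suc l) (Suc k))) * real (h n (Suc k)))"
    using l by (simp add: incidence_mat_def height_vec_def scalar_prod_def visits_def)
  also have "\<dots> = (\<Sum>k\<in>{1..C n}. real (card (visits n (Suc l) k)) * real (h n k))"
    by (simp add: sum.atLeast1_atMost_eq lessThan_atLeast0)
  also have "\<dots> = real (h (Suc n) (Suc l))"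
    using l by (subst height_Suc) simp_all
  finally show "(incidence_mat T C B h (Suc n) *\<^sub>v height_vec C h n) $ l = height_vec C h (Suc n) $ l"
    using l by (simp add: height_vec_def)
qed (simp add: incidence_mat_def height_vec_def)

lemma incidence_prod_carrier: "incidence_prod T C B h 1 (Suc n) \<in> carrier_mat (C (Suc n)) (C 1)"
proof (induction n)
  case (Suc n)
  have M: "incidence_mat T C B h (Suc (Suc n)) \<in> carrier_mat (C (Suc (Suc n))) (C (Suc n))"
    by (simp add: incidence_mat_def)
  have "incidence_prod T C B h 1 (Suc (Suc n)) = incidence_mat T C B h (Suc (Suc n)) * incidence_prod T C B h 1 (Suc n)"
    by simp
  then show ?case using mult_carrier_mat[OF M Suc] by presburger
qed simp

text \<open>Iterates the matrix form of \<open>height_Suc\<close>, starting from level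
  \<open>1\<close>, where the product is the identity.\<close>

lemma incidence_prod_mult_height_vec:
  "incidence_prod T C B h 1 (Suc n) *\<^sub>v height_vec C h 1 = height_vec C h (Suc n)"
proof (induction n)
  case 0
  have "height_vec C h 1 \<in> carrier_vec (C 1)" by (simp add: height_vec_def)
  then show ?case by simp
next
  case (Suc n)
  have M: "incidence_mat T C B h (Suc (Suc n)) \<in> carrier_mat (C (Suc (Suc n))) (C (Suc n))"
    by (simp add: incidence_mat_def)
  have H: "height_vec C h 1 \<in> carrier_vec (C 1)" by (simp add: height_vec_def)
  have "incidence_prod T C B h 1 (Suc (Suc n)) = incidence_mat T C B h (Suc (Suc n)) * incidence_prod T C B h 1 (Suc n)"
    by simp
  then show ?case
    using assoc_mult_mat_vec[OF M incidence_prod_carrier H] Suc incidence_mat_mult_height_vec[of "Suc n"]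
    by presburger
qed

lemma int_dist_height_le:
  assumes k: "k \<in> {1..C n}"
  shows "int_dist (\<alpha> * real (h n k)) \<le> int_dist_vec (\<alpha> \<cdot>\<^sub>v height_vec C h n)"
proof -
  obtain i where "k = Suc i" "i < C n" using k by (cases k) auto
  then show ?thesis
    using int_dist_vec_ge[of i "\<alpha> \<cdot>\<^sub>v height_vec C h n"] by (simp add: height_vec_def)
qed

lemma int_dist_height_attained:
  obtains k where "k \<in> {1..C n}" "int_dist_vec (\<alpha> \<cdot>\<^sub>v height_vec C h n) = int_dist (\<alpha> * real (h n k))"
proof -
  have "0 < dim_vec (\<alpha> \<cdot>\<^sub>v height_vec C h n)" using one_index[of n] by (simp add: height_vec_def)
  then obtain i where i: "i < dim_vec (\<alpha> \<cdot>\<^sub>v height_vec C h n)"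
    "int_dist_vec (\<alpha> \<cdot>\<^sub>v height_vec C h n) = int_dist ((\<alpha> \<cdot>\<^sub>v height_vec C h n) $ i)"
    by (rule int_dist_vec_attained)
  show thesis by (rule that[of "Suc i"]) (use i in \<open>simp_all add: height_vec_def\<close>)
qed

section \<open>The continuous eigenfunction\<close>

text \<open>Below the start \<open>j\<close> of a block lie complete blocks whose heights add up to
  \<open>j\<close>. There are at most \<open>L\<close> of them and each contributes at most
  \<open>e\<close>.\<close>

lemma norm_power_visit_le:
  fixes z :: "'b::real_normed_field"
  assumes l: "l \<in> {1..C (Suc n)}" and z: "norm z = 1"
    and e: "\<And>k. k \<in> {1..C n} \<Longrightarrow> norm (z ^ h n k - 1) \<le> e"
    and kj: "k \<in> {1..C n}" "j \<in> visits n l k"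
  shows "norm (z ^ j - 1) \<le> L * e"
proof -
  \<comment> \<open>All starting floors of blocks, so \<open>V \<inter> {..<j}\<close> counts the
    blocks below floor \<open>j\<close>.\<close>
  define V where "V = (\<Union>k\<in>{1..C n}. visits n l k)"
  have fin: "finite V" by (simp add: V_def)
  have e0: "0 \<le> e" using e[OF one_index] norm_ge_zero order_trans by blast
  have "norm (z ^ j - 1) \<le> real (card (V \<inter> {..<j})) * e"
    using kj
  proof (induction j arbitrary: k rule: less_induct)
    case (less j)
    show ?case
    proof (cases "j = 0")
      case False
      then obtain k' j' where k': "k' \<in> {1..C n}" "j' \<in> visits n l k'" "j = j' + h n k'"
        using visits_prev[OF l less.prems] by blast
      have "j' < j" using k' height_pos by simp
      have "insert j' (V \<inter> {..<j'}) \<subseteq> V \<inter> {..<j}"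
        using k' \<open>j' < j\<close> by (auto simp: V_def)
      then have "card (insert j' (V \<inter> {..<j'})) \<le> card (V \<inter> {..<j})"
        using fin by (intro card_mono) auto
      then have "card (V \<inter> {..<j'}) + 1 \<le> card (V \<inter> {..<j})"
        using fin by simp
      then have "(real (card (V \<inter> {..<j'})) + 1) * e \<le> real (card (V \<inter> {..<j})) * e"
        using e0 by (intro mult_right_mono) linarith+
      moreover have "norm (z ^ j - 1) \<le> norm (z ^ j' - 1) + norm (z ^ h n k' - 1)"
        unfolding k'(3) by (rule norm_power_diff_one_triangle[OF z])
      moreover note less.IH[OF \<open>j' < j\<close> k'(1,2)] e[OF k'(1)]
      ultimately show ?thesis by (simp add: algebra_simps)
    qed (use e0 in simp)
  qed
  also have "\<dots> \<le> L * e"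
  proof (rule mult_right_mono[OF _ e0])
    have "card (V \<inter> {..<j}) \<le> card V" using fin by (intro card_mono) auto
    also have "\<dots> \<le> (\<Sum>k\<in>{1..C n}. card (visits n l k))"
      unfolding V_def by (rule card_UN_le) simp
    finally have "real (card (V \<inter> {..<j})) \<le> (\<Sum>k\<in>{1..C n}. real (card (visits n l k)))"
      by (metis of_nat_le_iff of_nat_sum)
    with card_visits_le[OF l] show "real (card (V \<inter> {..<j})) \<le> L" by linarith
  qed
  finally show ?thesis .
qed

text \<open>The choice is harmless: \<open>tower_ex\<close> gives existence and
  \<open>tower_unique\<close> uniqueness.\<close>

definition level :: "nat \<Rightarrow> 'a \<Rightarrow> nat" where
  "level n x = (SOME j. \<exists>k\<in>{1..C n}. j < h n k \<and> (T ^^ j) x \<in> B n k)"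

lemma levelE:
  obtains k where "k \<in> {1..C n}" "level n x < h n k" "(T ^^ level n x) x \<in> B n k"
proof -
  obtain k j where "k \<in> {1..C n}" "j < h n k" "(T ^^ j) x \<in> B n k" by (rule tower_ex)
  then have "\<exists>k\<in>{1..C n}. level n x < h n k \<and> (T ^^ level n x) x \<in> B n k"
    unfolding level_def by (intro someI_ex[of "\<lambda>j. \<exists>k\<in>{1..C n}. j < h n k \<and> (T ^^ j) x \<in> B n k"]) blast
  then show thesis using that by blast
qed

lemma level_eq:
  assumes "k \<in> {1..C n}" "j < h n k" "(T ^^ j) x \<in> B n k"
  shows "level n x = j"
proof -
  obtain k' where "k' \<in> {1..C n}" "level n x < h n k'" "(T ^^ level n x) x \<in> B n k'" by (rule levelE)
  then show ?thesis using tower_unique[OF assms] by blast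
qed

text \<open>Floors are open, so \<open>level n\<close> is locally constant.\<close>

lemma continuous_on_level:
  fixes z :: "'b::{real_normed_field}"
  assumes T: "continuous_on UNIV T"
  shows "continuous_on UNIV (\<lambda>x. z ^ level n x)"
proof (unfold continuous_on_eq_continuous_at[OF open_UNIV], intro ballI)
  fix x
  obtain k where k: "k \<in> {1..C n}" "level n x < h n k" "(T ^^ level n x) x \<in> B n k" by (rule levelE)
  have cont: "continuous_on UNIV (T ^^ j)" for j
  proof (induction j)
    case (Suc j)
    then show ?case
      using continuous_on_compose[OF Suc continuous_on_subset[OF T subset_UNIV]] by simp
  qed (simp add: id_def)
  have "open ((T ^^ level n x) -` B n k)"
    by (intro open_vimage clopen_base k cont)
  then have "\<forall>\<^sub>F y in at x. y \<in> (T ^^ level n x) -` B n k"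
    using k by (auto simp: eventually_at_topological)
  then have "\<forall>\<^sub>F y in at x. z ^ level n y = z ^ level n x"
  proof eventually_elim
    case (elim y)
    then show ?case using level_eq[OF k(1,2), of y] by simp
  qed
  then show "isCont (\<lambda>x. z ^ level n x) x"
    unfolding isCont_def by (rule tendsto_eventually)
qed

text \<open>Off the base \<open>T\<close> lowers the level by one and the difference is
  \<open>0\<close>. From the base \<open>T\<close> jumps to a top floor, at level one less than some
  height, and the difference is \<open>ev\<close> times the distance of a height power from
  \<open>1\<close>.\<close>

lemma level_step_defect:
  fixes ev :: "'b::real_normed_field"
  assumes ev: "norm ev = 1" and e: "\<And>k. k \<in> {1..C n} \<Longrightarrow> norm (inverse ev ^ h n k - 1) \<le> e"
  shows "norm (inverse ev ^ level n (T x) - ev * inverse ev ^ level n x) \<le> e"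
proof -
  have e0: "0 \<le> e" using e[OF one_index] norm_ge_zero order_trans by blast
  have ev0: "ev \<noteq> 0" using ev by auto
  obtain k where k: "k \<in> {1..C n}" "level n x < h n k" "(T ^^ level n x) x \<in> B n k" by (rule levelE)
  show ?thesis
  proof (cases "level n x")
    case (Suc j)
    then have "level n (T x) = j"
      using k by (intro level_eq[of k]) (auto simp: funpow_swap1)
    then show ?thesis using Suc e0 ev0 by (simp flip: mult.assoc)
  next
    case 0
    obtain k' where k': "k' \<in> {1..C n}" "level n (T x) < h n k'" "(T ^^ level n (T x)) (T x) \<in> B n k'"
      by (rule levelE)
    have "Suc (level n (T x)) = h n k'"
      using above_base_top[of k n x k' "level n (T x)"] k k' 0 by (simp add: funpow_swap1)
    then have "inverse ev ^ level n (T x) - ev = ev * (inverse ev ^ h n k' - 1)"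
      using ev0 by (simp add: algebra_simps flip: \<open>Suc _ = _\<close>)
    then show ?thesis using e[OF k'(1)] ev 0 by (simp add: norm_mult)
  qed
qed

text \<open>The two levels differ by the starting floor of the block that contains
  \<open>x\<close>.\<close>

lemma level_refine_defect:
  fixes z :: "'b::real_normed_field"
  assumes z: "norm z = 1" and e: "\<And>k. k \<in> {1..C n} \<Longrightarrow> norm (z ^ h n k - 1) \<le> e"
  shows "norm (z ^ level (Suc n) x - z ^ level n x) \<le> L * e"
proof -
  obtain l where l: "l \<in> {1..C (Suc n)}" "level (Suc n) x < h (Suc n) l"
    and x: "(T ^^ level (Suc n) x) x \<in> B (Suc n) l"
    by (rule levelE)
  obtain k i where k: "k \<in> {1..C n}" "i < h n k" "i \<le> level (Suc n) x"
    and sub: "(T ^^ level (Suc n) x) -` B (Suc n) l \<subseteq> (T ^^ i) -` B n k"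
    and vis: "level (Suc n) x - i \<in> visits n l k"
    by (rule tower_refines[OF l])
  have i: "level n x = i" using x sub by (intro level_eq[OF k(1,2)]) blast
  have "z ^ level (Suc n) x - z ^ level n x = z ^ i * (z ^ (level (Suc n) x - i) - 1)"
    using k(3) by (simp add: i algebra_simps flip: power_add)
  then show ?thesis
    using norm_power_visit_le[OF l(1) z e k(1) vis] z by (simp add: norm_mult norm_power)
qed

text \<open>The limit function has modulus \<open>1\<close>, so it does not vanish, and it satisfies
  the eigenvalue equation because the bound of \<open>level_step_defect\<close> tends to
  \<open>0\<close>.\<close>

lemma continuous_eigenvalue_if_summable:
  fixes ev :: complex
  assumes T: "continuous_on UNIV T" and ev: "norm ev = 1" and summable: "summable e"
    and e: "\<And>n k. k \<in> {1..C (Suc n)} \<Longrightarrow> norm (inverse ev ^ h (Suc n) k - 1) \<le> e n"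
  shows "continuous_eigenvalue T ev"
proof -
  define g where "g n x = inverse ev ^ level (Suc n) x" for n x
  have z: "norm (inverse ev) = 1" using ev by (simp add: norm_inverse)
  \<comment> \<open>A telescoping series, so that the M-test yields uniform convergence of
    \<open>g\<close>. It starts at level \<open>1\<close>, the first level that \<open>e\<close>
    controls.\<close>
  define G where "G x = (\<Sum>n. g (Suc n) x - g n x) + g 0 x" for x
  have "norm (g (Suc n) x - g n x) \<le> L * e n" for n x
    unfolding g_def by (rule level_refine_defect[OF z e])
  then have "uniform_limit UNIV (\<lambda>n x. \<Sum>i<n. g (Suc i) x - g i x) (\<lambda>x. \<Sum>n. g (Suc n) x - g n x) sequentially"
    by (intro Weierstrass_m_test[where M = "\<lambda>n. L * e n"] summable_mult summable) auto
  then have "uniform_limit UNIV (\<lambda>n x. g n x - g 0 x) (\<lambda>x. \<Sum>n. g (Suc n) x - g n x) sequentially"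
    by (simp only: sum_lessThan_telescope[of "\<lambda>i. g i _"])
  then have "uniform_limit UNIV (\<lambda>n x. g n x - g 0 x + g 0 x) G sequentially"
    unfolding G_def by (intro uniform_limit_add uniform_limit_const)
  then have lim: "uniform_limit UNIV g G sequentially" by simp
  have tendsto: "(\<lambda>n. g n x) \<longlonglongrightarrow> G x" for x using tendsto_uniform_limitI[OF lim] by simp
  have "continuous_on UNIV G"
    using continuous_on_level[OF T]
    by (intro uniform_limit_theorem[OF _ lim] always_eventually) (auto simp: g_def[abs_def])
  moreover have norm_G: "norm (G x) = 1" for x
  proof (rule LIMSEQ_unique[OF tendsto_norm[OF tendsto]])
    show "(\<lambda>n. norm (g n x)) \<longlonglongrightarrow> 1" using z by (simp add: g_def norm_power)
  qed
  moreover have "G (T x) = ev * G x" for x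
  proof -
    have "(\<lambda>n. g n (T x) - ev * g n x) \<longlonglongrightarrow> 0"
    proof (rule Lim_null_comparison)
      show "\<forall>\<^sub>F n in sequentially. norm (g n (T x) - ev * g n x) \<le> e n"
        unfolding g_def using level_step_defect[OF ev e] by (intro always_eventually) blast
    qed (rule summable_LIMSEQ_zero[OF summable])
    moreover have "(\<lambda>n. g n (T x) - ev * g n x) \<longlonglongrightarrow> G (T x) - ev * G x"
      by (intro tendsto_intros tendsto)
    ultimately have "G (T x) - ev * G x = 0" by (rule LIMSEQ_unique[rotated])
    then show ?thesis by simp
  qed
  moreover have "G x \<noteq> 0" for x using norm_G[of x] by auto
  ultimately show ?thesis unfolding continuous_eigenvalue_def by blast
qed

end

section \<open>Averages of a measurable eigenfunction\<close>

locale lr_measure = lr_towers T C B h L + prob_space \<mu>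
  for T :: "'a::t2_space \<Rightarrow> 'a" and C B h L and \<mu> :: "'a measure" +
  assumes sets_eq_borel: "sets \<mu> = sets borel" and invariant: "distr \<mu> \<mu> T = \<mu>"
    and continuous_T: "continuous_on UNIV T" and KR4: "KR4 T C B h"
begin

lemma space_eq_UNIV [simp]: "space \<mu> = UNIV"
  using sets_eq_imp_space_eq[OF sets_eq_borel] by simp

lemma measurable_T: "T \<in> measurable \<mu> \<mu>"
  using borel_measurable_continuous_onI[OF continuous_T] measurable_cong_sets[OF sets_eq_borel sets_eq_borel]
  by simp

lemma base_sets: "k \<in> {1..C n} \<Longrightarrow> B n k \<in> sets \<mu>"
  using clopen_base by (simp add: sets_eq_borel)

lemma level_sets: "k \<in> {1..C n} \<Longrightarrow> (T ^^ j) -` B n k \<in> sets \<mu>"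
  using measurable_sets[OF measurable_compose_n[OF measurable_T] base_sets] by simp

text \<open>The general field allows three applications: the eigenfunction itself, and with
  \<open>z = 1\<close> the square of its modulus and the constant \<open>1\<close>.\<close>

context
  fixes g :: "'a \<Rightarrow> 'b::{banach, second_countable_topology, real_normed_field}" and z :: 'b
  assumes g: "integrable \<mu> g" "AE x in \<mu>. g x = z * g (T x)"
begin

lemma set_integral_level:
  "k \<in> {1..C n} \<Longrightarrow> (LINT x:(T ^^ j) -` B n k|\<mu>. g x) = z ^ j * (LINT x:B n k|\<mu>. g x)"
  using set_integral_funpow_vimage[OF measurable_T invariant g base_sets] by simp

lemma set_integral_levels:
  assumes I: "I \<subseteq> (SIGMA k:{1..C n}. {..<h n k})"
  shows "(LINT x:(\<Union>(k, j)\<in>I. (T ^^ j) -` B n k)|\<mu>. g x) = (\<Sum>(k, j)\<in>I. z ^ j * (LINT x:B n k|\<mu>. g x))"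
proof -
  have sets: "(case p of (k, j) \<Rightarrow> (T ^^ j) -` B n k) \<in> sets \<mu>" if "p \<in> I" for p
    using that I level_sets by auto
  have "(LINT x:(\<Union>p\<in>I. case p of (k, j) \<Rightarrow> (T ^^ j) -` B n k)|\<mu>. g x)
      = (\<Sum>p\<in>I. LINT x:(case p of (k, j) \<Rightarrow> (T ^^ j) -` B n k)|\<mu>. g x)"
  proof (rule set_integral_finite_Union)
    show "finite I" by (rule finite_subset[OF I]) auto
    show "disjoint_family_on (\<lambda>p. case p of (k, j) \<Rightarrow> (T ^^ j) -` B n k) I"
      by (rule disjoint_family_on_mono[OF I disjoint_tower_levels])
    show "set_integrable \<mu> (case p of (k, j) \<Rightarrow> (T ^^ j) -` B n k) g" if "p \<in> I" for p
      unfolding set_integrable_def by (rule integrable_mult_indicator[OF sets[OF that] g(1)])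
  qed (rule sets)
  also have "\<dots> = (\<Sum>(k, j)\<in>I. z ^ j * (LINT x:B n k|\<mu>. g x))"
    using I set_integral_level by (intro sum.cong) auto
  finally show ?thesis .
qed

lemma set_integral_base:
  assumes k: "k \<in> {1..C n}"
  shows "(LINT x:B n k|\<mu>. g x)
    = (\<Sum>(l, j)\<in>(SIGMA l:{1..C (Suc n)}. visits n l k). z ^ j * (LINT x:B (Suc n) l|\<mu>. g x))"
  by (subst base_decomp[OF k], rule set_integral_levels) (auto simp: visits_def)

lemma set_integral_total:
  "(LINT x|\<mu>. g x) = (\<Sum>k\<in>{1..C n}. \<Sum>j<h n k. z ^ j * (LINT x:B n k|\<mu>. g x))"
  using set_integral_levels[OF subset_refl, of n] unfolding UNIV_decomp
  by (simp add: sum.Sigma set_lebesgue_integral_def)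

end

section \<open>Lower bounds for the measure of the bases\<close>

lemma measure_base:
  assumes k: "k \<in> {1..C n}"
  shows "measure \<mu> (B n k) = (\<Sum>(l, j)\<in>(SIGMA l:{1..C (Suc n)}. visits n l k). measure \<mu> (B (Suc n) l))"
  using set_integral_base[of "\<lambda>_. 1::real" 1, OF _ _ k] by (simp add: set_lebesgue_integral_def)

lemma measure_towers: "(\<Sum>k\<in>{1..C n}. real (h n k) * measure \<mu> (B n k)) = 1"
proof -
  have "prob UNIV = (\<Sum>k\<in>{1..C n}. real (h n k) * measure \<mu> (B n k))"
    using set_integral_total[of "\<lambda>_. 1::real" 1 n] by (simp add: set_lebesgue_integral_def)
  then show ?thesis using prob_space[unfolded space_eq_UNIV] by (rule trans[OF sym])
qed

text \<open>The towers of level \<open>n + 1\<close> have total mass \<open>1\<close> and heights at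
  most \<open>L * h n k\<close>, so their bases have total measure at least
  \<open>1 / (L * h n k)\<close>. By \<open>KR5\<close> each of them has a preimage inside
  \<open>B n k\<close>.\<close>

lemma tower_measure_ge:
  assumes k: "k \<in> {1..C n}"
  shows "1 \<le> L * real (h n k) * measure \<mu> (B n k)"
proof -
  have Lh: "0 \<le> L * real (h n k)"
    using height_le[OF one_index k] by (rule order_trans[rotated]) simp
  have "1 = (\<Sum>l\<in>{1..C (Suc n)}. real (h (Suc n) l) * measure \<mu> (B (Suc n) l))"
    by (simp only: measure_towers)
  also have "\<dots> \<le> (\<Sum>l\<in>{1..C (Suc n)}. L * real (h n k) * measure \<mu> (B (Suc n) l))"
    using height_le k by (intro sum_mono mult_right_mono) auto
  also have "\<dots> = L * real (h n k) * (\<Sum>l\<in>{1..C (Suc n)}. measure \<mu> (B (Suc n) l))"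
    by (simp add: sum_distrib_left)
  also have "\<dots> \<le> L * real (h n k) * measure \<mu> (B n k)"
  proof (rule mult_left_mono[OF _ Lh])
    have "1 \<le> card (visits n l k)" if "l \<in> {1..C (Suc n)}" for l
      using visits_nonempty[OF that k] by (metis One_nat_def Suc_leI card_gt_0_iff empty_iff finite_visits)
    then have "(\<Sum>l\<in>{1..C (Suc n)}. 1 * measure \<mu> (B (Suc n) l))
        \<le> (\<Sum>l\<in>{1..C (Suc n)}. real (card (visits n l k)) * measure \<mu> (B (Suc n) l))"
      by (intro sum_mono mult_right_mono) (auto simp del: atLeastAtMost_iff simp: numeral_nat)
    also have "\<dots> = measure \<mu> (B n k)"
      unfolding measure_base[OF k] by (subst sum.Sigma[symmetric]) auto
    finally show "(\<Sum>l\<in>{1..C (Suc n)}. measure \<mu> (B (Suc n) l)) \<le> measure \<mu> (B n k)" by simp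
  qed
  finally show ?thesis .
qed

lemma measure_base_pos:
  assumes "k \<in> {1..C n}"
  shows "0 < measure \<mu> (B n k)"
  using tower_measure_ge[OF assms] by (cases "measure \<mu> (B n k) = 0") (simp_all add: zero_less_measure_iff)

lemma L_pos: "0 < L"
proof -
  have "0 < L * real (h 0 1)"
    using height_le[OF one_index one_index, of 0] height_pos[OF one_index, of "Suc 0"] by linarith
  then show ?thesis by (simp add: zero_less_mult_iff)
qed

section \<open>The atoms of all levels as an intersection-stable countable basis\<close>

lemma countable_atoms: "countable (\<Union>n. ckr_atoms T (C n) (B n) (h n))"
proof (rule countable_UN)
  fix n
  have "ckr_atoms T (C n) (B n) (h n) = (\<Union>k\<in>{1..C n}. (\<lambda>j. (T ^^ j) -` B n k) ` {..<h n k})"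
    unfolding ckr_atoms_def by (intro equalityI subsetI) blast+
  then show "countable (ckr_atoms T (C n) (B n) (h n))"
    by (simp add: countable_finite del: UN_simps)
qed simp

lemma atom_refines:
  assumes "A \<in> ckr_atoms T (C (n + m)) (B (n + m)) (h (n + m))"
  shows "\<exists>A'\<in>ckr_atoms T (C n) (B n) (h n). A \<subseteq> A'"
  using assms
proof (induction m arbitrary: A)
  case 0
  then show ?case by auto
next
  case (Suc m)
  obtain A' where A': "A' \<in> ckr_atoms T (C (n + m)) (B (n + m)) (h (n + m))" "A \<subseteq> A'"
    using KR2[unfolded KR2_def, rule_format, of A "n + m"] Suc.prems by auto
  then show ?case using Suc.IH[OF A'(1)] by blast
qed

text \<open>The partitions are nested, so two atoms are disjoint or one contains the other.\<close>

lemma Int_atoms: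
  assumes "U \<in> (\<Union>n. ckr_atoms T (C n) (B n) (h n))" "V \<in> (\<Union>n. ckr_atoms T (C n) (B n) (h n))"
  shows "U \<inter> V \<in> insert {} (\<Union>n. ckr_atoms T (C n) (B n) (h n))"
proof -
  have *: "U \<inter> V = {} \<or> V \<subseteq> U"
    if U: "U \<in> ckr_atoms T (C n) (B n) (h n)" and V: "V \<in> ckr_atoms T (C (n + m)) (B (n + m)) (h (n + m))" for U V n m
  proof -
    obtain A where A: "A \<in> ckr_atoms T (C n) (B n) (h n)" "V \<subseteq> A" using atom_refines[OF V] by blast
    have "disjoint (ckr_atoms T (C n) (B n) (h n))"
      using partition[of n] by (simp add: ckr_partition_def partition_on_def)
    then have "A = U \<or> A \<inter> U = {}" using U A(1) by (auto simp: disjoint_def)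
    then show ?thesis using A(2) by blast
  qed
  obtain n m where nm: "U \<in> ckr_atoms T (C n) (B n) (h n)" "V \<in> ckr_atoms T (C m) (B m) (h m)"
    using assms by blast
  show ?thesis
  proof (cases "n \<le> m")
    case True
    then have "U \<inter> V = {} \<or> V \<subseteq> U" using *[of U n V "m - n"] nm by simp
    then have "U \<inter> V = {} \<or> U \<inter> V = V" by blast
    then show ?thesis using assms(2) by auto
  next
    case False
    then have "V \<inter> U = {} \<or> U \<subseteq> V" using *[of V m U "n - m"] nm by simp
    then have "U \<inter> V = {} \<or> U \<inter> V = U" by blast
    then show ?thesis using assms(1) by auto
  qed
qed

end

text \<open>Here \<open>z\<close> is the inverse of the eigenvalue: floors are preimages, so going
  up one floor multiplies the integral by \<open>z\<close>.\<close>

locale lr_eigenfunction = lr_measure T C B h L \<mu>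
  for T :: "'a::t2_space \<Rightarrow> 'a" and C B h L and \<mu> :: "'a measure" +
  fixes f :: "'a \<Rightarrow> complex" and z :: complex
  assumes norm_z: "norm z = 1" and f_measurable: "f \<in> borel_measurable \<mu>"
    and f_square_integrable: "integrable \<mu> (\<lambda>x. (norm (f x))\<^sup>2)"
    and f_eigen: "AE x in \<mu>. f x = z * f (T x)"
begin

lemma f_integrable: "integrable \<mu> f"
proof -
  have "integrable \<mu> (\<lambda>x. norm (f x))"
    by (rule square_integrable_imp_integrable[OF measurable_compose[OF f_measurable borel_measurable_norm] f_square_integrable])
  then show ?thesis using integrable_norm_iff[OF f_measurable] by simp
qed

lemma norm_square_invariant: "AE x in \<mu>. (norm (f x))\<^sup>2 = 1 * (norm (f (T x)))\<^sup>2"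
  using f_eigen
proof eventually_elim
  case (elim x)
  then have "norm (f x) = norm (f (T x))" using norm_z by (metis mult_1 norm_mult)
  then show ?case by simp
qed

section \<open>Averages over bases and the energy of the conditional expectations\<close>

definition avg :: "nat \<Rightarrow> nat \<Rightarrow> complex" where
  "avg n k = (LINT x:B n k|\<mu>. f x) / of_real (measure \<mu> (B n k))"

text \<open>Since \<open>norm z = 1\<close>, this is the squared L2 norm of the conditional
  expectation of \<open>f\<close> on level \<open>n\<close>.\<close>

definition energy :: "nat \<Rightarrow> real" where
  "energy n = (\<Sum>k\<in>{1..C n}. real (h n k) * (measure \<mu> (B n k) * (norm (avg n k))\<^sup>2))"

lemma integral_base_eq_avg:
  "k \<in> {1..C n} \<Longrightarrow> (LINT x:B n k|\<mu>. f x) = of_real (measure \<mu> (B n k)) * avg n k"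
  using measure_base_pos[of k n] unfolding avg_def by (metis less_irrefl nonzero_mult_div_cancel_left of_real_eq_0_iff times_divide_eq_right)

text \<open>Orthogonality of martingale increments, written as a variance identity on each base \<open>B n k\<close>.\<close>
lemma energy_Suc:
  "energy (Suc n) = energy n + (\<Sum>k\<in>{1..C n}. real (h n k) *
    (\<Sum>(l, j)\<in>(SIGMA l:{1..C (Suc n)}. visits n l k). measure \<mu> (B (Suc n) l) * (norm (z ^ j * avg (Suc n) l - avg n k))\<^sup>2))"
proof -
  have var: "(\<Sum>(l, j)\<in>(SIGMA l:{1..C (Suc n)}. visits n l k). measure \<mu> (B (Suc n) l) * (norm (z ^ j * avg (Suc n) l - avg n k))\<^sup>2)
      = (\<Sum>l\<in>{1..C (Suc n)}. real (card (visits n l k)) * (measure \<mu> (B (Suc n) l) * (norm (avg (Suc n) l))\<^sup>2))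
        - measure \<mu> (B n k) * (norm (avg n k))\<^sup>2" (is "?V = ?R - _")
    if k: "k \<in> {1..C n}" for k
  proof -
    let ?S = "SIGMA l:{1..C (Suc n)}. visits n l k"
    have W: "(\<Sum>p\<in>?S. measure \<mu> (B (Suc n) (fst p))) = measure \<mu> (B n k)"
      unfolding measure_base[OF k] by (rule sum.cong) auto
    have "(\<Sum>p\<in>?S. of_real (measure \<mu> (B (Suc n) (fst p))) * (z ^ snd p * avg (Suc n) (fst p)))
        = (\<Sum>(l, j)\<in>?S. z ^ j * (LINT x:B (Suc n) l|\<mu>. f x))"
    proof (rule sum.cong[OF refl], unfold case_prod_unfold)
      fix p assume "p \<in> ?S"
      then have "fst p \<in> {1..C (Suc n)}" by auto
      then show "of_real (measure \<mu> (B (Suc n) (fst p))) * (z ^ snd p * avg (Suc n) (fst p))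
          = z ^ snd p * (LINT x:B (Suc n) (fst p)|\<mu>. f x)"
        by (simp only: integral_base_eq_avg mult.left_commute)
    qed
    also have "\<dots> = of_real (measure \<mu> (B n k)) * avg n k"
      by (simp only: set_integral_base[OF f_integrable f_eigen k, symmetric] integral_base_eq_avg[OF k])
    finally have "(\<Sum>p\<in>?S. measure \<mu> (B (Suc n) (fst p)) * (norm (z ^ snd p * avg (Suc n) (fst p) - avg n k))\<^sup>2)
      = (\<Sum>p\<in>?S. measure \<mu> (B (Suc n) (fst p)) * (norm (z ^ snd p * avg (Suc n) (fst p)))\<^sup>2)
        - measure \<mu> (B n k) * (norm (avg n k))\<^sup>2"
      using sum_weighted_variance[of "\<lambda>p. measure \<mu> (B (Suc n) (fst p))" "\<lambda>p. z ^ snd p * avg (Suc n) (fst p)" ?S "avg n k"]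
      unfolding W by blast
    moreover have "(\<Sum>p\<in>?S. measure \<mu> (B (Suc n) (fst p)) * (norm (z ^ snd p * avg (Suc n) (fst p)))\<^sup>2) = ?R"
    proof -
      have "?R = (\<Sum>l\<in>{1..C (Suc n)}. \<Sum>j\<in>visits n l k. measure \<mu> (B (Suc n) l) * (norm (avg (Suc n) l))\<^sup>2)"
        by simp
      also have "\<dots> = (\<Sum>(l, j)\<in>?S. measure \<mu> (B (Suc n) l) * (norm (avg (Suc n) l))\<^sup>2)"
        by (rule sum.Sigma) auto
      finally show ?thesis unfolding case_prod_unfold norm_mult norm_power norm_z power_one mult_1_left by (rule sym)
    qed
    ultimately show ?thesis unfolding case_prod_unfold by (simp only:)
  qed
  \<comment> \<open>Exchanging the sums lets \<open>height_Suc\<close> collect the block heights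
    into the height of tower \<open>l\<close>.\<close>
  have "(\<Sum>k\<in>{1..C n}. real (h n k) * (\<Sum>l\<in>{1..C (Suc n)}. real (card (visits n l k)) *
      (measure \<mu> (B (Suc n) l) * (norm (avg (Suc n) l))\<^sup>2)))
    = (\<Sum>l\<in>{1..C (Suc n)}. \<Sum>k\<in>{1..C n}. real (card (visits n l k)) * real (h n k) *
      (measure \<mu> (B (Suc n) l) * (norm (avg (Suc n) l))\<^sup>2))"
    unfolding sum_distrib_left by (subst sum.swap) (simp only: mult_ac)
  also have "\<dots> = energy (Suc n)"
    unfolding energy_def
    by (intro sum.cong refl) (simp only: height_Suc of_nat_sum of_nat_mult sum_distrib_right)
  finally have total: "(\<Sum>k\<in>{1..C n}. real (h n k) * (\<Sum>l\<in>{1..C (Suc n)}. real (card (visits n l k)) *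
      (measure \<mu> (B (Suc n) l) * (norm (avg (Suc n) l))\<^sup>2))) = energy (Suc n)" .
  have "(\<Sum>k\<in>{1..C n}. real (h n k) *
    (\<Sum>(l, j)\<in>(SIGMA l:{1..C (Suc n)}. visits n l k). measure \<mu> (B (Suc n) l) * (norm (z ^ j * avg (Suc n) l - avg n k))\<^sup>2))
    = (\<Sum>k\<in>{1..C n}. real (h n k) * ((\<Sum>l\<in>{1..C (Suc n)}. real (card (visits n l k)) *
      (measure \<mu> (B (Suc n) l) * (norm (avg (Suc n) l))\<^sup>2)) - measure \<mu> (B n k) * (norm (avg n k))\<^sup>2))"
    by (intro sum.cong refl) (simp only: var)
  also have "\<dots> = energy (Suc n) - energy n"
    unfolding total[symmetric] energy_def[of n] by (simp only: right_diff_distrib sum_subtractf)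
  finally show ?thesis by linarith
qed

text \<open>Bessel's inequality: on each base the integral of the squared distance of
  \<open>f\<close> from its average is nonnegative. Since \<open>norm (f x)\<close> is invariant,
  all floors of a tower contribute equally.\<close>

lemma energy_le: "energy n \<le> (LINT x|\<mu>. (norm (f x))\<^sup>2)"
proof -
  have "measure \<mu> (B n k) * (norm (avg n k))\<^sup>2 \<le> (LINT x:B n k|\<mu>. (norm (f x))\<^sup>2)"
    if k: "k \<in> {1..C n}" for k
  proof -
    let ?a = "avg n k" and ?w = "measure \<mu> (B n k)"
    have ind: "set_integrable \<mu> (B n k) g" if "integrable \<mu> g" for g :: "'a \<Rightarrow> 'c::{banach, second_countable_topology}"
      using integrable_mult_indicator[OF base_sets[OF k] that] by (simp add: set_integrable_def)
    have eq: "(norm (f x - ?a))\<^sup>2 = (norm (f x))\<^sup>2 - 2 * Re (cnj ?a * f x) + (norm ?a)\<^sup>2" for x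
      unfolding cmod_power2 by (simp add: power2_eq_square algebra_simps)
    have Re: "(LINT x:B n k|\<mu>. Re (cnj ?a * f x)) = ?w * (norm ?a)\<^sup>2"
    proof -
      have "(LINT x:B n k|\<mu>. Re (cnj ?a * f x)) = (LINT x|\<mu>. Re (cnj ?a * (indicator (B n k) x *\<^sub>R f x)))"
        unfolding set_lebesgue_integral_def by (intro Bochner_Integration.integral_cong) (auto simp: indicator_def)
      also have "\<dots> = Re (LINT x|\<mu>. cnj ?a * (indicator (B n k) x *\<^sub>R f x))"
        using ind[OF f_integrable] unfolding set_integrable_def by (intro integral_Re integrable_mult_right) auto
      also have "\<dots> = Re (cnj ?a * (of_real ?w * ?a))"
        unfolding integral_mult_right_zero using integral_base_eq_avg[OF k] by (simp add: set_lebesgue_integral_def)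
      finally show ?thesis unfolding cmod_power2 by (simp add: power2_eq_square algebra_simps)
    qed
    have "0 \<le> (LINT x:B n k|\<mu>. (norm (f x))\<^sup>2 - 2 * Re (cnj ?a * f x) + (norm ?a)\<^sup>2)"
      unfolding eq[symmetric] set_lebesgue_integral_def by (intro integral_nonneg_AE) simp
    also have "\<dots> = (LINT x:B n k|\<mu>. (norm (f x))\<^sup>2) - 2 * (LINT x:B n k|\<mu>. Re (cnj ?a * f x)) + ?w * (norm ?a)\<^sup>2"
    proof -
      have i: "set_integrable \<mu> (B n k) (\<lambda>x. (norm (f x))\<^sup>2)" "set_integrable \<mu> (B n k) (\<lambda>x. 2 * Re (cnj ?a * f x))"
        "set_integrable \<mu> (B n k) (\<lambda>x. (norm ?a)\<^sup>2)"
        using f_square_integrable f_integrable by (auto intro!: ind integrable_Re)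
      have const: "(LINT x:B n k|\<mu>. (norm ?a)\<^sup>2) = ?w * (norm ?a)\<^sup>2"
        by (simp add: set_lebesgue_integral_def)
      show ?thesis
        by (simp only: set_integral_add(2)[OF set_integral_diff(1)[OF i(1,2)] i(3)]
          set_integral_diff(2)[OF i(1,2)] set_integral_mult_right const)
    qed
    finally show ?thesis unfolding Re by simp
  qed
  then have "energy n \<le> (\<Sum>k\<in>{1..C n}. real (h n k) * (LINT x:B n k|\<mu>. (norm (f x))\<^sup>2))"
    unfolding energy_def by (intro sum_mono mult_left_mono) auto
  also have "\<dots> = (LINT x|\<mu>. (norm (f x))\<^sup>2)"
    using set_integral_total[OF f_square_integrable norm_square_invariant, of n] by simp
  finally show ?thesis .
qed

section \<open>Martingale increments and pointwise comparison of averages\<close>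

definition gap :: "nat \<Rightarrow> real" where
  "gap n = energy (Suc n) - energy n"

lemma gap_nonneg: "0 \<le> gap n"
  unfolding gap_def energy_Suc add_diff_cancel_left' case_prod_unfold
  by (intro sum_nonneg mult_nonneg_nonneg) simp_all

lemma energy_mono:
  assumes "m \<le> n"
  shows "energy m \<le> energy n"
proof (rule lift_Suc_mono_le[OF _ assms])
  show "energy i \<le> energy (Suc i)" for i using gap_nonneg[of i] by (simp add: gap_def)
qed

lemma summable_gap: "summable gap"
proof (rule summableI_nonneg_bounded)
  fix n
  have "sum gap {..<n} = energy n - energy 0"
    unfolding gap_def by (rule sum_lessThan_telescope)
  moreover have "0 \<le> energy 0" unfolding energy_def by (intro sum_nonneg mult_nonneg_nonneg) simp_all
  ultimately show "sum gap {..<n} \<le> (LINT x|\<mu>. (norm (f x))\<^sup>2)" using energy_le[of n] by linarith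
qed (rule gap_nonneg)

text \<open>The squared bound in \<open>avg_visit\<close> picks up \<open>L\<close> twice: from the
  measure of a base and from the ratio of two heights.\<close>

definition defect :: "nat \<Rightarrow> real" where
  "defect n = L * sqrt (gap n)"

lemma defect_nonneg: "0 \<le> defect n"
  using L_pos gap_nonneg by (simp add: defect_def)

text \<open>A single term of the sum in \<open>energy_Suc\<close> is at most \<open>gap n\<close>,
  and its weight, height times measure, is at least \<open>1 / L^2\<close>.\<close>

lemma avg_visit:
  assumes l: "l \<in> {1..C (Suc n)}" and k: "k \<in> {1..C n}" and j: "j \<in> visits n l k"
  shows "norm (z ^ j * avg (Suc n) l - avg n k) \<le> defect n"
proof -
  let ?N = "(norm (z ^ j * avg (Suc n) l - avg n k))\<^sup>2" and ?w = "measure \<mu> (B (Suc n) l)"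
  define F where "F k = (\<lambda>(l, j). measure \<mu> (B (Suc n) l) * (norm (z ^ j * avg (Suc n) l - avg n k))\<^sup>2)" for k
  have F: "0 \<le> F k p" for k p by (simp add: F_def case_prod_unfold)
  have "?w * ?N = F k (l, j)" by (simp add: F_def)
  also have "\<dots> \<le> sum (F k) (SIGMA l:{1..C (Suc n)}. visits n l k)"
    by (rule member_le_sum) (use l j F in auto)
  finally have "real (h n k) * (?w * ?N) \<le> real (h n k) * sum (F k) (SIGMA l:{1..C (Suc n)}. visits n l k)"
    by (rule mult_left_mono) simp
  also have "\<dots> \<le> (\<Sum>k\<in>{1..C n}. real (h n k) * sum (F k) (SIGMA l:{1..C (Suc n)}. visits n l k))"
    by (rule member_le_sum[of k _ "\<lambda>k. real (h n k) * sum (F k) (SIGMA l:{1..C (Suc n)}. visits n l k)"])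
      (use k F in \<open>simp_all add: sum_nonneg\<close>)
  also have "\<dots> = gap n" unfolding gap_def energy_Suc F_def by simp
  finally have gap: "real (h n k) * (?w * ?N) \<le> gap n" .
  have "1 * ?N \<le> (L * real (h (Suc n) l) * ?w) * ?N"
    by (rule mult_right_mono[OF tower_measure_ge[OF l]]) simp
  also have "\<dots> = (L * (?w * ?N)) * real (h (Suc n) l)" by (simp only: mult_ac)
  also have "\<dots> \<le> (L * (?w * ?N)) * (L * real (h n k))"
    using L_pos by (intro mult_left_mono height_le l k) simp
  also have "\<dots> = L\<^sup>2 * (real (h n k) * (?w * ?N))" by (simp only: power2_eq_square mult_ac)
  also have "\<dots> \<le> L\<^sup>2 * gap n" using gap by (rule mult_left_mono) simp
  also have "\<dots> = (defect n)\<^sup>2" using gap_nonneg by (simp add: defect_def power_mult_distrib)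
  finally have "?N \<le> (defect n)\<^sup>2" by simp
  then show ?thesis by (rule power2_le_imp_le[OF _ defect_nonneg])
qed

text \<open>By \<open>KR6\<close> every tower starts with a block of type \<open>1\<close> on floor
  \<open>0\<close>, where no power of \<open>z\<close> appears. So all averages of level
  \<open>n + 1\<close> are close to the same number.\<close>

lemma avg_first:
  assumes "l \<in> {1..C (Suc n)}"
  shows "norm (avg (Suc n) l - avg n 1) \<le> defect n"
  using avg_visit[OF assms one_index visits_zero[OF assms]] by simp

lemma avg_oscillation:
  assumes "k \<in> {1..C (Suc n)}" "k' \<in> {1..C (Suc n)}"
  shows "norm (avg (Suc n) k - avg (Suc n) k') \<le> 2 * defect n"
  using avg_first[OF assms(1)] avg_first[OF assms(2)]
    norm_triangle_ineq4[of "avg (Suc n) k - avg n 1" "avg (Suc n) k' - avg n 1"] by simp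

lemma norm_z_power_mult_diff: "norm (z ^ m * a - z ^ m * b) = norm (a - b)"
  by (simp add: norm_mult norm_power norm_z flip: right_diff_distrib)

text \<open>If tower 1 is not followed by another block inside tower 1 of the next level, then it is the only
  tower of level \<open>n\<close>, and its base is invariant under \<open>T ^^ h n 1\<close>.\<close>
lemma avg_top_of_first_tower:
  obtains l where "l \<in> {1..C n}" "norm (z ^ h n 1 * avg n 1 - avg n l) \<le> 2 * defect n"
proof (cases "h n 1 < h (Suc n) 1")
  case True
  have zero: "0 \<in> visits n 1 1" by (rule visits_zero[OF one_index])
  obtain l where l: "l \<in> {1..C n}" "h n 1 \<in> visits n 1 l"
    using visits_next[OF one_index one_index zero] True by auto
  \<comment> \<open>The first and the second block of tower \<open>1\<close> are compared through
    the common value on the floor where the second one starts.\<close>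
  have "norm (z ^ h n 1 * avg (Suc n) 1 - z ^ h n 1 * avg n 1) \<le> defect n"
    using avg_visit[OF one_index one_index zero] by (simp add: norm_z_power_mult_diff)
  moreover have "norm (z ^ h n 1 * avg (Suc n) 1 - avg n l) \<le> defect n"
    by (rule avg_visit[OF one_index l])
  ultimately have "norm (z ^ h n 1 * avg n 1 - avg n l) \<le> 2 * defect n"
    using norm_triangle_ineq4[of "z ^ h n 1 * avg (Suc n) 1 - avg n l" "z ^ h n 1 * avg (Suc n) 1 - z ^ h n 1 * avg n 1"]
    by simp
  then show thesis using that l(1) by blast
next
  case False
  \<comment> \<open>The first block fills tower \<open>1\<close> of level \<open>n + 1\<close>. By
    \<open>KR5\<close> a block of type \<open>k\<close> starts in this tower, hence inside the first
    block, and distinct blocks do not overlap.\<close>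
  have one: "k = 1" if k: "k \<in> {1..C n}" for k
  proof -
    obtain j where j: "j \<in> visits n 1 k" by (rule visits_nonempty[OF one_index k])
    then have "j < h n 1" using False by (simp add: visits_def)
    then show ?thesis
      using visits_unique[OF one_index k one_index height_pos[OF k] _ j visits_zero[OF one_index], of j] by simp
  qed
  have "(T ^^ h n 1) -` B n 1 = B n 1"
  proof (intro equalityI subsetI)
    fix x assume "x \<in> (T ^^ h n 1) -` B n 1"
    then show "x \<in> B n 1" using return_to_base[OF one_index, of n x] one by (metis vimageD)
  next
    fix x assume x: "x \<in> B n 1"
    obtain k i where k: "k \<in> {1..C n}" "i < h n k" "(T ^^ i) (T x) \<in> B n k" by (rule tower_ex)
    have "(T ^^ Suc i) x \<in> B n 1" "i < h n 1" using k one[OF k(1)] by (auto simp: funpow_swap1)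
    then show "x \<in> (T ^^ h n 1) -` B n 1"
      using above_base_top[OF one_index x one_index, of i] by (metis vimageI2)
  qed
  then have "(LINT x:B n 1|\<mu>. f x) = z ^ h n 1 * (LINT x:B n 1|\<mu>. f x)"
    using set_integral_level[OF f_integrable f_eigen one_index, of "h n 1" n] by simp
  then have "z ^ h n 1 * avg n 1 = avg n 1" unfolding avg_def by (metis times_divide_eq_right)
  then have "norm (z ^ h n 1 * avg n 1 - avg n 1) \<le> 2 * defect n"
    using defect_nonneg[of n] by (simp only: diff_self norm_zero)
  then show thesis by (rule that[OF one_index])
qed

text \<open>Take a block of type \<open>k\<close> in tower \<open>1\<close> of level
  \<open>n + 2\<close> and the value \<open>u\<close> just above it. It is close to
  \<open>z ^ h (Suc n) k\<close> times the average on that block, and also to the average on what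
  follows, which \<open>avg_oscillation\<close> compares with \<open>avg (Suc n) k\<close>.\<close>

lemma height_defect:
  assumes k: "k \<in> {1..C (Suc n)}"
  shows "norm (z ^ h (Suc n) k - 1) * norm (avg (Suc n) k)
    \<le> 2 * (defect (Suc (Suc n)) + defect (Suc n) + defect n)"
proof -
  let ?m = "Suc n" and ?p = "Suc (Suc n)"
  obtain j where j: "j \<in> visits ?m 1 k" by (rule visits_nonempty[OF one_index k])
  define u where "u = z ^ (j + h ?m k) * avg ?p 1"
  have "norm (z ^ h ?m k * (z ^ j * avg ?p 1) - z ^ h ?m k * avg ?m k) \<le> defect ?m"
    unfolding norm_z_power_mult_diff by (rule avg_visit[OF one_index k j])
  then have u: "norm (u - z ^ h ?m k * avg ?m k) \<le> defect ?m"
    by (simp add: u_def power_add mult_ac)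
  have goal: "norm (z ^ h ?m k - 1) * norm (avg ?m k) = norm (z ^ h ?m k * avg ?m k - avg ?m k)"
    by (simp add: norm_mult[symmetric] left_diff_distrib)
  have *: "norm (u - avg ?m k) \<le> 2 * defect ?p + defect ?m + 2 * defect n"
  proof (cases "j + h ?m k < h ?p 1")
    case True
    obtain k' where k': "k' \<in> {1..C ?m}" "j + h ?m k \<in> visits ?m 1 k'"
      by (rule visits_next[OF one_index k j True])
    have "norm (u - avg ?m k') \<le> defect ?m"
      unfolding u_def by (rule avg_visit[OF one_index k'])
    then show ?thesis
      using avg_oscillation[OF k'(1) k] defect_nonneg[of ?p]
        norm_triangle_ineq[of "u - avg ?m k'" "avg ?m k' - avg ?m k"] by simp
  next
    case False
    \<comment> \<open>The block ends at the top of the tower, so what follows is a tower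
      \<open>l\<close> of level \<open>n + 2\<close>, whose first block has type
      \<open>1\<close>.\<close>
    then have eq: "j + h ?m k = h ?p 1" using visits_fit[OF one_index k j] by simp
    obtain l where l: "l \<in> {1..C ?p}" "norm (u - avg ?p l) \<le> 2 * defect ?p"
      unfolding u_def eq by (rule avg_top_of_first_tower)
    then show ?thesis
      using avg_first[OF l(1)] avg_oscillation[OF one_index k]
        norm_triangle_ineq[of "u - avg ?p l" "avg ?p l - avg ?m 1"]
        norm_triangle_ineq[of "u - avg ?m 1" "avg ?m 1 - avg ?m k"] by simp
  qed
  show ?thesis
    unfolding goal using u * norm_triangle_ineq4[of "u - avg ?m k" "u - z ^ h ?m k * avg ?m k"] by simp
qed

section \<open>Averages bounded away from zero\<close>

text \<open>If all averages vanished, so would the integrals of \<open>f\<close> over all atoms,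
  which form a basis of the topology by \<open>KR4\<close>.\<close>

lemma energy_pos_if_nonzero:
  assumes "\<not> (AE x in \<mu>. f x = 0)"
  obtains n where "0 < energy n"
proof -
  have "\<exists>n. \<exists>k\<in>{1..C n}. avg n k \<noteq> 0"
  proof (rule ccontr)
    assume "\<not> ?thesis"
    then have base: "(LINT x:B n k|\<mu>. f x) = 0" if "k \<in> {1..C n}" for n k
      using integral_base_eq_avg[OF that] that by simp
    have "AE x in \<mu>. f x = 0"
    proof (rule AE_eq_0_if_integral_basis_eq_0[OF sets_eq_borel f_integrable countable_atoms])
      show "topological_basis (\<Union>n. ckr_atoms T (C n) (B n) (h n))"
        using KR4 by (simp add: KR4_def)
      fix U assume "U \<in> insert UNIV (\<Union>n. ckr_atoms T (C n) (B n) (h n))"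
      then consider "U = UNIV" | n k j where "k \<in> {1..C n}" "U = (T ^^ j) -` B n k"
        by (auto simp: ckr_atoms_def)
      then show "(LINT x:U|\<mu>. f x) = 0"
      proof cases
        case 1
        then show ?thesis
          using set_integral_total[OF f_integrable f_eigen, of 0] base by (simp add: set_lebesgue_integral_def)
      next
        case 2
        then show ?thesis using set_integral_level[OF f_integrable f_eigen] base by simp
      qed
    qed (rule Int_atoms)
    then show False using assms by simp
  qed
  then obtain n k where k: "k \<in> {1..C n}" "avg n k \<noteq> 0" by blast
  have "0 < real (h n k) * (measure \<mu> (B n k) * (norm (avg n k))\<^sup>2)"
    using k height_pos[OF k(1)] measure_base_pos[OF k(1)] by simp
  also have "\<dots> \<le> energy n"
    unfolding energy_def
    by (rule member_le_sum[of k _ "\<lambda>k. real (h n k) * (measure \<mu> (B n k) * (norm (avg n k))\<^sup>2)"])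
      (use k in auto)
  finally show thesis by (rule that)
qed

text \<open>The energy is a weighted mean of the squared moduli of the averages, with weights of sum
  \<open>1\<close> by \<open>measure_towers\<close>.\<close>

lemma avg_large:
  assumes "0 < e" "e \<le> energy n"
  obtains k where "k \<in> {1..C n}" "e \<le> (norm (avg n k))\<^sup>2"
proof (rule ccontr)
  note large = that
  assume "\<not> thesis"
  then have small: "(norm (avg n k))\<^sup>2 < e" if "k \<in> {1..C n}" for k
    using large[OF that] by linarith
  have "energy n < (\<Sum>k\<in>{1..C n}. real (h n k) * (measure \<mu> (B n k) * e))"
    unfolding energy_def
    using small height_pos measure_base_pos one_index
    by (intro sum_strict_mono mult_strict_left_mono) auto
  also have "\<dots> = e * (\<Sum>k\<in>{1..C n}. real (h n k) * measure \<mu> (B n k))"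
    by (simp add: sum_distrib_left mult_ac)
  also have "\<dots> = e" by (simp only: measure_towers mult_1_right)
  finally show False using assms by simp
qed

lemma summable_defect_square: "summable (\<lambda>n. (defect n)\<^sup>2)"
  using summable_mult[OF summable_gap, of "L\<^sup>2"] gap_nonneg
  by (simp add: defect_def power_mult_distrib)

text \<open>The energy increases, so each late level has one large average; the others are close to
  it because the oscillation tends to \<open>0\<close>.\<close>

lemma avg_bounded_below:
  assumes "\<not> (AE x in \<mu>. f x = 0)"
  obtains c N where "0 < c" "\<And>n k. N \<le> n \<Longrightarrow> k \<in> {1..C (Suc n)} \<Longrightarrow> c \<le> norm (avg (Suc n) k)"
proof -
  obtain M where M: "0 < energy M" by (rule energy_pos_if_nonzero[OF assms])
  \<comment> \<open>One average has modulus at least \<open>2 * c\<close>; once the defect is below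
    \<open>c / 2\<close>, the oscillation is below \<open>c\<close> and leaves \<open>c\<close> for
    the others.\<close>
  define c where "c = sqrt (energy M) / 2"
  have c: "0 < c" using M by (simp add: c_def)
  have "\<forall>\<^sub>F n in sequentially. (defect n)\<^sup>2 < (c / 2)\<^sup>2"
    using c by (intro order_tendstoD(2)[OF summable_LIMSEQ_zero[OF summable_defect_square]]) simp
  then obtain N where N: "\<And>n. N \<le> n \<Longrightarrow> (defect n)\<^sup>2 < (c / 2)\<^sup>2"
    by (auto simp: eventually_sequentially)
  have "c \<le> norm (avg (Suc n) k)" if n: "max M N \<le> n" and k: "k \<in> {1..C (Suc n)}" for n k
  proof -
    obtain k' where k': "k' \<in> {1..C (Suc n)}" "energy M \<le> (norm (avg (Suc n) k'))\<^sup>2"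
      using avg_large[OF M energy_mono[of M "Suc n"]] n by auto
    then have "2 * c \<le> norm (avg (Suc n) k')"
      using M by (simp add: c_def real_le_lsqrt)
    moreover have "defect n < c / 2"
      using N[of n] n c by (intro power2_less_imp_less[of _ "c / 2"]) auto
    moreover note avg_oscillation[OF k'(1) k] norm_triangle_ineq2[of "avg (Suc n) k'" "avg (Suc n) k"]
    ultimately show ?thesis by linarith
  qed
  then show thesis using that[OF c] by blast
qed

lemma eigenvalue_defect_summable:
  assumes "\<not> (AE x in \<mu>. f x = 0)"
  obtains s N where "summable s"
    "\<And>n k. N \<le> n \<Longrightarrow> k \<in> {1..C (Suc n)} \<Longrightarrow> (norm (z ^ h (Suc n) k - 1))\<^sup>2 \<le> s n"
proof -
  obtain c N where c: "0 < c" and avg: "\<And>n k. N \<le> n \<Longrightarrow> k \<in> {1..C (Suc n)} \<Longrightarrow> c \<le> norm (avg (Suc n) k)"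
    using avg_bounded_below[OF assms] by blast
  let ?t = "\<lambda>n. defect (Suc (Suc n)) + defect (Suc n) + defect n"
  \<comment> \<open>The factor \<open>12\<close> is \<open>4 * 3\<close>: the square of the
    \<open>2\<close> in \<open>height_defect\<close>, and \<open>3\<close> from bounding the square
    of a sum of three terms by the sum of squares.\<close>
  define s where "s n = 12 / c\<^sup>2 * ((defect (Suc (Suc n)))\<^sup>2 + (defect (Suc n))\<^sup>2 + (defect n)\<^sup>2)" for n
  have "summable s"
    unfolding s_def
    using summable_defect_square summable_Suc_iff[of "\<lambda>n. (defect n)\<^sup>2"]
      summable_Suc_iff[of "\<lambda>n. (defect (Suc n))\<^sup>2"]
    by (intro summable_mult summable_add) simp_all
  moreover have "(norm (z ^ h (Suc n) k - 1))\<^sup>2 \<le> s n" if n: "N \<le> n" and k: "k \<in> {1..C (Suc n)}" for n k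
  proof -
    let ?x = "norm (z ^ h (Suc n) k - 1)"
    have "?x * c \<le> 2 * ?t n"
      using mult_left_mono[OF avg[OF n k], of ?x] height_defect[OF k] by simp
    then have "(?x * c)\<^sup>2 \<le> (2 * ?t n)\<^sup>2" using c by (intro power_mono) auto
    also have "\<dots> \<le> 12 * ((defect (Suc (Suc n)))\<^sup>2 + (defect (Suc n))\<^sup>2 + (defect n)\<^sup>2)"
      using sum_squares_ge_zero[of "defect (Suc (Suc n)) - defect (Suc n)" "defect (Suc n) - defect n"]
        zero_le_square[of "defect (Suc (Suc n)) - defect n"]
      by (simp add: power2_eq_square algebra_simps)
    finally show ?thesis using c by (simp add: s_def power_mult_distrib field_simps)
  qed
  ultimately show thesis by (rule that)
qed

end

section \<open>From powers at the heights to the two series\<close>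

theorem theorem10:
  fixes T :: "'a::t2_space \<Rightarrow> 'a"
    and C :: "nat \<Rightarrow> nat"
    and B :: "nat \<Rightarrow> nat \<Rightarrow> 'a set"
    and h :: "nat \<Rightarrow> nat \<Rightarrow> nat"
    and \<mu> :: "'a measure"
    and \<alpha> :: real
    and ev :: complex
  assumes "minimal_cantor_system T"
    and "linearly_recurrent_sequence T C B h"
    and "invariant_prob_measure T \<mu>"
    and "ev = exp (2 * \<i> * complex_of_real pi * complex_of_real \<alpha>)"
  shows "(measurable_eigenvalue T \<mu> ev \<longrightarrow>
            summable (\<lambda>n. (int_dist_vec
              (\<alpha> \<cdot>\<^sub>v (incidence_prod T C B h 1 (Suc n) *\<^sub>v height_vec C h 1)))\<^sup>2)) \<and>
         (summable (\<lambda>n. int_dist_vec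
              (\<alpha> \<cdot>\<^sub>v (incidence_prod T C B h 1 (Suc n) *\<^sub>v height_vec C h 1))) \<longrightarrow>
            continuous_eigenvalue T ev)"
proof -
  obtain S where S: "homeomorphism UNIV UNIV T S"
    using assms(1) unfolding minimal_cantor_system_def cantor_system_def by blast
  have surj: "surj T" and cont: "continuous_on UNIV T"
    using S unfolding homeomorphism_def by blast+
  obtain L :: real where L: "\<forall>n\<ge>1. \<forall>l\<in>{1..C n}. \<forall>k\<in>{1..C (n - 1)}. real (h n l) \<le> L * real (h (n - 1) k)"
    using assms(2) unfolding linearly_recurrent_sequence_def LR_def by blast
  interpret lr_towers T C B h L
  proof
    show "ckr_partition T (C n) (B n) (h n)" for n
      using assms(2) unfolding linearly_recurrent_sequence_def ckr_sequence_def by blast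
    show "real (h (Suc n) l) \<le> L * real (h n k)" if "l \<in> {1..C (Suc n)}" "k \<in> {1..C n}" for n l k
      using L[rule_format, of "Suc n" l k] that by simp
  qed (use surj assms(2) in \<open>simp_all add: linearly_recurrent_sequence_def\<close>)
  \<comment> \<open>Index \<open>n\<close> stands for level \<open>n + 1\<close>, so both series
    start at level \<open>1\<close>.\<close>
  define d where "d n = int_dist_vec (\<alpha> \<cdot>\<^sub>v height_vec C h (Suc n))" for n
  have norm_ev: "norm ev = 1"
    using norm_exp_i_times[of "2 * pi * \<alpha>"] by (simp add: assms(4) mult_ac)
  \<comment> \<open>Inversion on the unit circle keeps the distance to \<open>1\<close>, so powers
    of \<open>inverse ev\<close> measure the distance of \<open>\<alpha> * real m\<close> to the
    integers.\<close>
  have power_ev: "norm (inverse ev ^ m - 1)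
      = norm (exp (2 * \<i> * complex_of_real pi * complex_of_real (\<alpha> * real m)) - 1)" for m
    unfolding norm_inverse_power_minus_one[OF norm_ev] unfolding assms(4)
    by (simp add: mult_ac flip: exp_of_nat_mult)
  have "summable (\<lambda>n. (d n)\<^sup>2)" if eigen: "measurable_eigenvalue T \<mu> ev"
  proof -
    obtain f :: "'a \<Rightarrow> complex" where f: "f \<in> borel_measurable \<mu>" "integrable \<mu> (\<lambda>x. (norm (f x))\<^sup>2)"
      "\<not> (AE x in \<mu>. f x = 0)" "AE x in \<mu>. f (T x) = ev * f x"
      using eigen unfolding measurable_eigenvalue_def by blast
    have eig: "AE x in \<mu>. f x = inverse ev * f (T x)"
      using f(4)
    proof eventually_elim
      case (elim x)
      have "ev \<noteq> 0" using norm_ev by auto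
      then show ?case unfolding elim by (simp flip: mult.assoc)
    qed
    interpret prob_space \<mu> using assms(3) by (simp add: invariant_prob_measure_def)
    interpret lr_eigenfunction T C B h L \<mu> f "inverse ev"
    proof
      show "sets \<mu> = sets borel" "distr \<mu> \<mu> T = \<mu>" using assms(3) by (simp_all add: invariant_prob_measure_def)
      show "KR4 T C B h" using assms(2) by (simp add: linearly_recurrent_sequence_def)
      show "norm (inverse ev) = 1" using norm_ev by (simp add: norm_inverse)
    qed (fact cont f(1) f(2) eig)+
    obtain s N where s: "summable s"
      "\<And>n k. N \<le> n \<Longrightarrow> k \<in> {1..C (Suc n)} \<Longrightarrow> (norm (inverse ev ^ h (Suc n) k - 1))\<^sup>2 \<le> s n"
      using eigenvalue_defect_summable[OF f(3)] by blast
    show ?thesis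
    proof (rule summable_comparison_test'[OF s(1)])
      fix n assume "N \<le> n"
      obtain k where k: "k \<in> {1..C (Suc n)}" "d n = int_dist (\<alpha> * real (h (Suc n) k))"
        unfolding d_def by (rule int_dist_height_attained)
      have "d n \<le> norm (inverse ev ^ h (Suc n) k - 1)"
        unfolding k(2) power_ev by (rule int_dist_le_norm_exp)
      moreover have "0 \<le> d n" unfolding k(2) by (simp add: int_dist_def)
      ultimately have "(d n)\<^sup>2 \<le> (norm (inverse ev ^ h (Suc n) k - 1))\<^sup>2" by (rule power_mono)
      also have "\<dots> \<le> s n" by (rule s(2)[OF \<open>N \<le> n\<close> k(1)])
      finally show "norm ((d n)\<^sup>2) \<le> s n" by simp
    qed
  qed
  moreover have "continuous_eigenvalue T ev" if "summable d"
  proof (rule continuous_eigenvalue_if_summable[OF cont norm_ev])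
    show "summable (\<lambda>n. 2 * pi * d n)" using that by (rule summable_mult)
    fix n k assume k: "k \<in> {1..C (Suc n)}"
    have "norm (inverse ev ^ h (Suc n) k - 1) \<le> 2 * pi * int_dist (\<alpha> * real (h (Suc n) k))"
      unfolding power_ev by (rule norm_exp_2pi_i_le)
    also have "\<dots> \<le> 2 * pi * d n"
      unfolding d_def by (rule mult_left_mono[OF int_dist_height_le[OF k]]) simp
    finally show "norm (inverse ev ^ h (Suc n) k - 1) \<le> 2 * pi * d n" .
  qed
  ultimately show ?thesis
    unfolding incidence_prod_mult_height_vec d_def by blast
qed

end
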